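(* Let $G$ be a $\tau$-group of nilpotency class $c$ such that $\Gamma_c(G)$ has rank at least $2$. Then no Nickel embedding of $G$ into a unitriangular group $UT_d(\mathbb{Z})$ has undistorted image.
   Context: A $\tau$-group is a finitely generated torsion-free non-abelian nilpotent group; $\Gamma_1(G)=G$, $\Gamma_{i+1}(G)=[\Gamma_i(G),G]$, $c$ is least with $\Gamma_{c+1}(G)=1$, and the rank of the free abelian group $\Gamma_c(G)$ is its number of free generators. Nickel embedding: take a Mal'cev basis $(x_1,\dots,x_r)$ of $G$ associated with a refinement, with infinite cyclic factors, of the series of isolators of the lower central series, so every $g\in G$ is uniquely $x_1^{a_1}\cdots x_r^{a_r}$. Let $t_i:G\to\mathbb{Z}$, $x_1^{a_1}\cdots x_r^{a_r}\mapsto a_i$, viewed in $(\mathbb{Q}G)^*$, on which $G$ acts by $f^g(h)=f(hg^{-1})$. The $G$-submodule $M$ generated by $t_1,\dots,t_r$ is finite-dimensional and faithful; an ordered $\mathbb{Q}$-basis of $M$ for which all matrices are upper unitriangular integer matrices gives an embedding $G\to UT_d(\mathbb{Z})$, $d=\dim M$. The image $H$ is undistorted in $K=UT_d(\mathbb{Z})$ if $\Delta_H^K(n)=\max\{dist_H(1,h): h\in H, dist_K(1,h)\le n\}$ (word metrics) satisfies $\Delta_H^K(n)\le Cn$ for a constant $C$. *)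

theory Defs
  imports "HOL-Algebra.Generated_Groups" "Jordan_Normal_Form.Matrix"
begin

text \<open>Lower central series: gamma_1 = G, gamma_(i+1) = [gamma_i, G].
  lcs G n is gamma_(n+1); lower_central G i is gamma_i for i \<ge> 1.\<close>

primrec lcs :: "('a, 'b) monoid_scheme \<Rightarrow> nat \<Rightarrow> 'a set" where
  "lcs G 0 = carrier G"
| "lcs G (Suc n) = generate G
     {inv\<^bsub>G\<^esub> x \<otimes>\<^bsub>G\<^esub> inv\<^bsub>G\<^esub> y \<otimes>\<^bsub>G\<^esub> x \<otimes>\<^bsub>G\<^esub> y | x y. x \<in> lcs G n \<and> y \<in> carrier G}"

definition lower_central :: "('a, 'b) monoid_scheme \<Rightarrow> nat \<Rightarrow> 'a set" where
  "lower_central G i = lcs G (i - 1)"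

definition nilpotent_group :: "('a, 'b) monoid_scheme \<Rightarrow> bool" where
  "nilpotent_group G \<longleftrightarrow> (\<exists>c. lower_central G (Suc c) = {\<one>\<^bsub>G\<^esub>})"

definition nilpotency_class :: "('a, 'b) monoid_scheme \<Rightarrow> nat" where
  "nilpotency_class G = (LEAST c. lower_central G (Suc c) = {\<one>\<^bsub>G\<^esub>})"

definition finitely_generated_group :: "('a, 'b) monoid_scheme \<Rightarrow> bool" where
  "finitely_generated_group G \<longleftrightarrow>
     (\<exists>S. finite S \<and> S \<subseteq> carrier G \<and> generate G S = carrier G)"

definition torsion_free :: "('a, 'b) monoid_scheme \<Rightarrow> bool" where
  "torsion_free G \<longleftrightarrow>
     (\<forall>g \<in> carrier G. \<forall>n::nat. n > 0 \<and> g [^]\<^bsub>G\<^esub> n = \<one>\<^bsub>G\<^esub> \<longrightarrow> g = \<one>\<^bsub>G\<^esub>)"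

definition tau_group :: "('a, 'b) monoid_scheme \<Rightarrow> bool" where
  "tau_group G \<longleftrightarrow> group G \<and> finitely_generated_group G \<and> torsion_free G
     \<and> \<not> (\<forall>x \<in> carrier G. \<forall>y \<in> carrier G. x \<otimes>\<^bsub>G\<^esub> y = y \<otimes>\<^bsub>G\<^esub> x)
     \<and> nilpotent_group G"

definition word_prod :: "('a, 'b) monoid_scheme \<Rightarrow> 'a list \<Rightarrow> int list \<Rightarrow> 'a" where
  "word_prod G xs as = foldr (\<lambda>(x, a) acc. x [^]\<^bsub>G\<^esub> a \<otimes>\<^bsub>G\<^esub> acc) (zip xs as) \<one>\<^bsub>G\<^esub>"

text \<open>bs is a free (abelian) basis of the subgroup H: every element of H is uniquely a
  product of integer powers of the (distinct) elements of bs. The rank of a free abelian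
  group is the length of any such basis.\<close>
definition free_basis :: "('a, 'b) monoid_scheme \<Rightarrow> 'a set \<Rightarrow> 'a list \<Rightarrow> bool" where
  "free_basis G H bs \<longleftrightarrow> distinct bs \<and> set bs \<subseteq> H \<and>
     (\<forall>h \<in> H. \<exists>!as. length as = length bs \<and> h = word_prod G bs as)"

definition isolator :: "('a, 'b) monoid_scheme \<Rightarrow> 'a set \<Rightarrow> 'a set" where
  "isolator G H = {g \<in> carrier G. \<exists>n::nat. n > 0 \<and> g [^]\<^bsub>G\<^esub> n \<in> H}"

definition malcev_series :: "('a, 'b) monoid_scheme \<Rightarrow> 'a list \<Rightarrow> nat \<Rightarrow> 'a set" where
  "malcev_series G xs i = generate G (set (drop i xs))"

text \<open>Mal'cev basis associated with a refinement, with infinite cyclic factors, of the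
  series of isolators of the lower central series:
  G = G_0 \<ge> G_1 \<ge> ... \<ge> G_r = 1, G_(i+1) normal in G_i, G_i/G_(i+1) infinite cyclic
  generated by x_i G_(i+1), and each isolator I(gamma_j), 1 \<le> j \<le> c+1, is a term G_i.\<close>
definition nickel_malcev_basis :: "('a, 'b) monoid_scheme \<Rightarrow> 'a list \<Rightarrow> bool" where
  "nickel_malcev_basis G xs \<longleftrightarrow>
     set xs \<subseteq> carrier G \<and>
     malcev_series G xs 0 = carrier G \<and>
     (\<forall>i < length xs.
        (\<forall>g \<in> malcev_series G xs i. \<forall>h \<in> malcev_series G xs (Suc i).
           g \<otimes>\<^bsub>G\<^esub> h \<otimes>\<^bsub>G\<^esub> inv\<^bsub>G\<^esub> g \<in> malcev_series G xs (Suc i)) \<and>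
        (\<forall>g \<in> malcev_series G xs i. \<exists>!n::int.
           inv\<^bsub>G\<^esub> ((xs ! i) [^]\<^bsub>G\<^esub> n) \<otimes>\<^bsub>G\<^esub> g \<in> malcev_series G xs (Suc i))) \<and>
     (\<forall>j \<in> {1 .. Suc (nilpotency_class G)}. \<exists>i \<le> length xs.
        malcev_series G xs i = isolator G (lower_central G j))"

definition malcev_coord :: "('a, 'b) monoid_scheme \<Rightarrow> 'a list \<Rightarrow> nat \<Rightarrow> 'a \<Rightarrow> rat" where
  "malcev_coord G xs i g =
     (if g \<in> carrier G
      then of_int ((THE as. length as = length xs \<and> g = word_prod G xs as) ! i)
      else 0)"

definition fun_act :: "('a, 'b) monoid_scheme \<Rightarrow> 'a \<Rightarrow> ('a \<Rightarrow> rat) \<Rightarrow> ('a \<Rightarrow> rat)" where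
  "fun_act G g f = (\<lambda>h. if h \<in> carrier G then f (h \<otimes>\<^bsub>G\<^esub> inv\<^bsub>G\<^esub> g) else 0)"

definition lincomb :: "rat list \<Rightarrow> ('a \<Rightarrow> rat) list \<Rightarrow> ('a \<Rightarrow> rat)" where
  "lincomb cs fs = (\<lambda>x. \<Sum>i < length fs. cs ! i * (fs ! i) x)"

definition nickel_module :: "('a, 'b) monoid_scheme \<Rightarrow> 'a list \<Rightarrow> ('a \<Rightarrow> rat) set" where
  "nickel_module G xs =
     {f. \<exists>ps cs. set ps \<subseteq> carrier G \<times> {..< length xs} \<and> length cs = length ps \<and>
        f = lincomb cs (map (\<lambda>(g, i). fun_act G g (malcev_coord G xs i)) ps)}"

definition nickel_basis :: "('a, 'b) monoid_scheme \<Rightarrow> 'a list \<Rightarrow> ('a \<Rightarrow> rat) list \<Rightarrow> bool" where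
  "nickel_basis G xs fs \<longleftrightarrow>
     set fs \<subseteq> nickel_module G xs \<and>
     (\<forall>cs. length cs = length fs \<and> lincomb cs fs = (\<lambda>_. 0) \<longrightarrow> (\<forall>c \<in> set cs. c = 0)) \<and>
     (\<forall>f \<in> nickel_module G xs. \<exists>cs. length cs = length fs \<and> f = lincomb cs fs) \<and>
     (\<forall>g \<in> carrier G. \<forall>j < length fs. \<exists>cs::int list. length cs = length fs \<and>
        fun_act G g (fs ! j) = lincomb (map of_int cs) fs \<and>
        cs ! j = 1 \<and> (\<forall>k < j. cs ! k = 0))"

definition nickel_map :: "('a, 'b) monoid_scheme \<Rightarrow> ('a \<Rightarrow> rat) list \<Rightarrow> 'a \<Rightarrow> int mat" where
  "nickel_map G fs g = mat (length fs) (length fs) (\<lambda>(j, k).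
     (THE cs::int list. length cs = length fs \<and>
        fun_act G g (fs ! j) = lincomb (map of_int cs) fs) ! k)"

definition UT :: "nat \<Rightarrow> int mat monoid" where
  "UT d = \<lparr> carrier = {A \<in> carrier_mat d d. \<forall>i < d. A $$ (i, i) = 1 \<and> (\<forall>j < i. A $$ (i, j) = 0)},
            monoid.mult = (*), one = 1\<^sub>m d \<rparr>"

definition word_length :: "('a, 'b) monoid_scheme \<Rightarrow> 'a set \<Rightarrow> 'a \<Rightarrow> nat" where
  "word_length K S h = (LEAST n. \<exists>ws. length ws = n \<and>
      set ws \<subseteq> S \<union> m_inv K ` S \<and> foldr (\<otimes>\<^bsub>K\<^esub>) ws \<one>\<^bsub>K\<^esub> = h)"

definition distortion :: "('a, 'b) monoid_scheme \<Rightarrow> 'a set \<Rightarrow> 'a set \<Rightarrow> 'a set \<Rightarrow> nat \<Rightarrow> nat" where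
  "distortion K SK H SH n =
     Max {word_length K SH h | h. h \<in> H \<and> word_length K SK h \<le> n}"

text \<open>H is undistorted in K (w.r.t. word metrics of finite generating sets; the property
  does not depend on the choice of finite generating sets).\<close>
definition undistorted :: "('a, 'b) monoid_scheme \<Rightarrow> 'a set \<Rightarrow> bool" where
  "undistorted K H \<longleftrightarrow>
     (\<exists>SK SH. finite SK \<and> SK \<subseteq> carrier K \<and> generate K SK = carrier K \<and>
        finite SH \<and> SH \<subseteq> H \<and> generate K SH = H \<and>
        (\<exists>C::real. \<forall>n. real (distortion K SK H SH n) \<le> C * real n))"

end

theory Submission
  imports Defs "Jordan_Normal_Form.Gauss_Jordan_Elimination"
begin

text \<open>Give the isolator \<open>Iso w\<close> of the \<open>w\<close>-th term of the lower central series the weight \<open>w\<close>; then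
  the Mal'cev coordinates are polynomial functions of weighted degree at most \<open>c\<close>. Hence on the ball
  of radius \<open>l\<close> in \<open>G\<close> they are \<open>O(l ^ c)\<close>, and every \<open>h \<in> \<Gamma>\<^sub>c\<close> moves each function of
  the Nickel module by a constant. The constants are spanned by the last basis function, so the matrix
  of \<open>h\<close> differs from the identity only in the last column. This column meets the \<open>c\<close>-th
  superdiagonal in a single entry, and all entries below that superdiagonal vanish because
  \<open>h \<in> \<Gamma>\<^sub>c\<close>. As \<open>\<Gamma>\<^sub>c\<close> has rank at least 2, that single entry vanishes for some
  \<open>h \<noteq> 1\<close>. Then the \<open>n ^ (c + 1)\<close>-th power of \<open>h\<close> has length \<open>O(n)\<close> in the
  unitriangular group (iterated commutators of elementary matrices), while in \<open>G\<close> its length is at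
  least of order \<open>n ^ ((c + 1) / c)\<close>.\<close>

section \<open>Lower central series\<close>

text \<open>Why the exponent \<open>c + 1\<close>: a word of length O(n) in the unitriangular group
  can put n^p on the p-th superdiagonal, while degree \<open>c\<close> on the group side already
  allows growth l^c. A nonzero entry on the c-th superdiagonal would thus yield no contradiction;
  once it is gone, all remaining entries lie on superdiagonal \<open>c + 1\<close> or higher and
  n^(c+1) is affordable. Why isolators: the Mal'cev series is only known to run through the
  isolators, so it is \<open>Iso w\<close> that is a term of the series and fits the coordinates.
  The price is that commutators of \<open>Iso v\<close> and \<open>Iso w\<close> must be shown to
  lie in \<open>Iso (v + w)\<close>, which needs extraction of roots in torsion-free nilpotent
  quotients. Why differences: polynomials are defined by iterated differences, not by formulas in
  coordinates. This notion is stable under translations and linear combinations, so it passes from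
  the coordinates to the whole module, and no explicit multiplication polynomials are
  computed.\<close>

context group
begin

abbreviation cmt :: "'a \<Rightarrow> 'a \<Rightarrow> 'a" where
  "cmt x y \<equiv> inv x \<otimes> inv y \<otimes> x \<otimes> y"

lemma cancel_left [simp]:
  assumes "x \<in> carrier G" "y \<in> carrier G"
  shows "x \<otimes> (inv x \<otimes> y) = y" "inv x \<otimes> (x \<otimes> y) = y"
  using assms by (simp_all flip: m_assoc)

text \<open>Free cancellation. Its use: if two of the three double commutators lie in a normal
  subgroup, so does the third.\<close>

lemma Hall_Witt:
  assumes "a \<in> carrier G" "b \<in> carrier G" "x \<in> carrier G"
  shows "(b \<otimes> cmt (cmt a b) x \<otimes> inv b)
    \<otimes> (inv x \<otimes> cmt (cmt (inv b) (inv x)) a \<otimes> x)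
    \<otimes> (inv a \<otimes> cmt (cmt x (inv a)) (inv b) \<otimes> a) = \<one>"
  using assms by (simp add: m_assoc inv_mult_group)

lemma lcs_subgroup: "subgroup (lcs G n) G"
proof (induction n)
  case 0
  then show ?case by (simp add: subgroup_self)
next
  case (Suc n)
  then have "lcs G n \<subseteq> carrier G" by (simp add: subgroup.subset)
  then show ?case by (auto intro!: generate_is_subgroup)
qed

lemma lcs_carrier: "x \<in> lcs G n \<Longrightarrow> x \<in> carrier G"
  by (rule subgroup.mem_carrier[OF lcs_subgroup])

lemma lcs_normal: "lcs G n \<lhd> G"
proof (induction n)
  case 0
  show ?case by (simp add: normal_invI subgroup_self)
next
  case (Suc n)
  show ?case
    unfolding lcs.simps
  proof (rule normal_generateI)
    show "{cmt x y |x y. x \<in> lcs G n \<and> y \<in> carrier G} \<subseteq> carrier G"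
      by (auto dest: lcs_carrier)
    fix h g assume g: "g \<in> carrier G" and "h \<in> {cmt x y |x y. x \<in> lcs G n \<and> y \<in> carrier G}"
    then obtain x y where h: "h = cmt x y" "x \<in> lcs G n" "y \<in> carrier G" by blast
    then have "g \<otimes> h \<otimes> inv g = cmt (g \<otimes> x \<otimes> inv g) (g \<otimes> y \<otimes> inv g)"
      using g lcs_carrier[of x n] by (simp add: m_assoc inv_mult_group)
    moreover have "g \<otimes> x \<otimes> inv g \<in> lcs G n"
      using Suc g h by (simp add: normal.inv_op_closed2)
    moreover have "g \<otimes> y \<otimes> inv g \<in> carrier G" using g h by simp
    ultimately show "g \<otimes> h \<otimes> inv g \<in> {cmt x y |x y. x \<in> lcs G n \<and> y \<in> carrier G}"
      by blast
  qed
qed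

lemma lcs_conj: "x \<in> lcs G n \<Longrightarrow> g \<in> carrier G \<Longrightarrow> inv g \<otimes> x \<otimes> g \<in> lcs G n"
  by (simp add: lcs_normal normal.inv_op_closed1)

lemma lcs_commutator: "x \<in> lcs G n \<Longrightarrow> y \<in> carrier G \<Longrightarrow> cmt x y \<in> lcs G (Suc n)"
  by (auto intro!: generate.incl)

lemma commutator_swap:
  "x \<in> carrier G \<Longrightarrow> y \<in> carrier G \<Longrightarrow> cmt y x = inv (cmt x y)"
  by (simp add: m_assoc inv_mult_group)

lemma lcs_commutator': "x \<in> carrier G \<Longrightarrow> y \<in> lcs G n \<Longrightarrow> cmt x y \<in> lcs G (Suc n)"
  using commutator_swap[of y x] lcs_commutator[of y n x] lcs_subgroup[of "Suc n"] lcs_carrier[of y n]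
  by (simp add: subgroup.m_inv_closed del: lcs.simps)

lemma lcs_antimono_Suc: "lcs G (Suc n) \<subseteq> lcs G n"
proof -
  have "cmt x y \<in> lcs G n" if "x \<in> lcs G n" "y \<in> carrier G" for x y
  proof -
    have "cmt x y = inv x \<otimes> (inv y \<otimes> x \<otimes> y)"
      using that lcs_carrier[of x n] by (simp add: m_assoc)
    then show ?thesis
      using that lcs_conj[of x n y] lcs_subgroup[of n]
      by (simp add: subgroup.m_closed subgroup.m_inv_closed)
  qed
  then show ?thesis
    unfolding lcs.simps by (intro generate_subgroup_incl lcs_subgroup) auto
qed

lemma lcs_antimono: "m \<le> n \<Longrightarrow> lcs G n \<subseteq> lcs G m"
  by (rule lift_Suc_antimono_le) (rule lcs_antimono_Suc)

text \<open>Three-subgroup argument by induction on \<open>j\<close>. As \<open>lcs G i\<close> is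
  the term of index i+1, the indices add up to i+j+2, hence the \<open>Suc\<close>.\<close>

lemma lcs_lcs_commutator:
  "x \<in> lcs G i \<Longrightarrow> y \<in> lcs G j \<Longrightarrow> cmt x y \<in> lcs G (Suc (i + j))"
proof (induction j arbitrary: i x y)
  case 0
  then show ?case using lcs_commutator by simp
next
  case (Suc j)
  define N where "N = lcs G (Suc (i + Suc j))"
  have N: "subgroup N G" by (simp add: N_def lcs_subgroup del: lcs.simps)
  have x: "x \<in> carrier G" using Suc.prems lcs_carrier by blast
  let ?S = "{cmt a b |a b. a \<in> lcs G j \<and> b \<in> carrier G}"
  have S: "?S \<subseteq> carrier G" by (auto dest: lcs_carrier)
  \<comment> \<open>Hall-Witt for \<open>a\<close>, \<open>b\<close>, \<open>x\<close>: the
    induction hypothesis puts two factors into \<open>N\<close>, once applied with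
    \<open>Suc i\<close> and once followed by a further commutator with
    \<open>inv b\<close>.\<close>
  have gen: "cmt x h \<in> N" if "h \<in> ?S" for h
  proof -
    from that obtain a b where h: "h = cmt a b" "a \<in> lcs G j" "b \<in> carrier G" by blast
    have a: "a \<in> carrier G" using h lcs_carrier by blast
    have "inv x \<in> lcs G i"
      using Suc.prems(1) by (rule subgroup.m_inv_closed[OF lcs_subgroup])
    then have "cmt (inv b) (inv x) \<in> lcs G (Suc i)"
      using h by (intro lcs_commutator') auto
    then have "cmt (cmt (inv b) (inv x)) a \<in> N"
      using Suc.IH[of "cmt (inv b) (inv x)" "Suc i" a] h by (simp add: N_def del: lcs.simps)
    then have 1: "inv x \<otimes> cmt (cmt (inv b) (inv x)) a \<otimes> x \<in> N"
      unfolding N_def by (rule lcs_conj[OF _ x])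
    have "inv a \<in> lcs G j"
      using h(2) by (rule subgroup.m_inv_closed[OF lcs_subgroup])
    then have "cmt x (inv a) \<in> lcs G (Suc (i + j))"
      by (rule Suc.IH[OF Suc.prems(1)])
    then have "cmt (cmt x (inv a)) (inv b) \<in> N"
      using lcs_commutator[of _ "Suc (i+j)" "inv b"] h by (simp add: N_def del: lcs.simps)
    then have 2: "inv a \<otimes> cmt (cmt x (inv a)) (inv b) \<otimes> a \<in> N"
      unfolding N_def by (rule lcs_conj[OF _ a])
    let ?u = "inv x \<otimes> cmt (cmt (inv b) (inv x)) a \<otimes> x"
    let ?v = "inv a \<otimes> cmt (cmt x (inv a)) (inv b) \<otimes> a"
    let ?w = "b \<otimes> cmt h x \<otimes> inv b"
    have c: "?u \<in> carrier G" "?v \<in> carrier G" "?w \<in> carrier G"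
      using x a h by auto
    have "?w \<otimes> (?u \<otimes> ?v) = \<one>"
      using Hall_Witt[OF a h(3) x] c unfolding h(1) by (simp only: m_assoc)
    then have "?w = inv (?u \<otimes> ?v)"
      using c by (metis inv_equality m_closed)
    then have "?w \<in> N"
      using 1 2 N by (simp add: subgroup.m_closed subgroup.m_inv_closed)
    then have "inv b \<otimes> ?w \<otimes> b \<in> N"
      unfolding N_def by (rule lcs_conj[OF _ h(3)])
    moreover have "inv b \<otimes> ?w \<otimes> b = cmt h x"
      using x a h by (simp add: m_assoc)
    ultimately have "inv (cmt h x) \<in> N"
      using N subgroup.m_inv_closed by fastforce
    then show ?thesis
      using commutator_swap[of h x] x a h by simp
  qed
  \<comment> \<open>This is a subgroup because \<open>N\<close> is normal, so the generators
    \<open>?S\<close> suffice.\<close>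
  let ?C = "{y \<in> carrier G. cmt x y \<in> N}"
  have "subgroup ?C G"
  proof (rule subgroupI)
    show "?C \<noteq> {}"
      using x N by (auto simp: m_assoc subgroup.one_closed intro!: exI[of _ \<one>])
  next
    fix y assume y: "y \<in> ?C"
    have "cmt x (inv y) = inv (inv y) \<otimes> inv (cmt x y) \<otimes> inv y"
      using x y by (simp add: m_assoc inv_mult_group)
    moreover have "inv (cmt x y) \<in> N" using y N subgroup.m_inv_closed by fastforce
    ultimately show "inv y \<in> ?C"
      using y lcs_conj[of "inv (cmt x y)" "Suc (i + Suc j)" "inv y"] by (simp add: N_def del: lcs.simps)
  next
    fix y z assume y: "y \<in> ?C" and z: "z \<in> ?C"
    have "cmt x (y \<otimes> z) = cmt x z \<otimes> (inv z \<otimes> cmt x y \<otimes> z)"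
      using x y z by (simp add: m_assoc inv_mult_group)
    moreover have "inv z \<otimes> cmt x y \<otimes> z \<in> N"
      using y z lcs_conj[of "cmt x y" "Suc (i + Suc j)" z] by (simp add: N_def del: lcs.simps)
    ultimately show "y \<otimes> z \<in> ?C"
      using y z N by (simp add: subgroup.m_closed)
  qed auto
  moreover have "?S \<subseteq> ?C" using gen S by auto
  ultimately have "generate G ?S \<subseteq> ?C" by (rule generate_subgroup_incl[rotated])
  then show ?case using Suc.prems by (auto simp: N_def)
qed

text \<open>Downward induction along the chain: \<open>z = cmt x y\<close> is one level deeper, and
  \<open>x \<otimes> z\<close> is a conjugate of \<open>x\<close> with the same n-th power, so
  \<open>x [^] n\<close> commutes with \<open>z\<close>. By induction \<open>x\<close> does too,
  whence \<open>z [^] n = \<one>\<close>. The chain \<open>C\<close> is abstract so that images of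
  \<open>lcs\<close> in a quotient can be inserted.\<close>

lemma isolated_commutation:
  assumes torsion_free: "\<And>g n. g \<in> carrier G \<Longrightarrow> n > 0 \<Longrightarrow> g [^] (n::nat) = \<one> \<Longrightarrow> g = \<one>"
    and C: "C 0 = carrier G" "C m = {\<one>}"
      "\<And>k x y. x \<in> carrier G \<Longrightarrow> y \<in> C k \<Longrightarrow> cmt x y \<in> C (Suc k)"
      "\<And>k. C k \<subseteq> carrier G"
    and xy: "x \<in> carrier G" "y \<in> carrier G" "n > 0" "x [^] (n::nat) \<otimes> y = y \<otimes> x [^] n"
  shows "x \<otimes> y = y \<otimes> x"
proof -
  have "\<forall>y \<in> C k. x [^] n \<otimes> y = y \<otimes> x [^] n \<longrightarrow> x \<otimes> y = y \<otimes> x" if "k \<le> m" for k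
    using that
  proof (induction rule: inc_induct)
    case base
    then show ?case using C xy by simp
  next
    case (step k)
    show ?case
    proof (intro ballI impI)
      fix y assume y: "y \<in> C k" and comm: "x [^] n \<otimes> y = y \<otimes> x [^] n"
      have yc: "y \<in> carrier G" using y C by blast
      define z where "z = cmt x y"
      have z: "z \<in> C (Suc k)" "z \<in> carrier G" using C xy y yc by (auto simp: z_def)
      have xz: "x \<otimes> z = inv y \<otimes> x \<otimes> y" using xy yc by (simp add: z_def m_assoc)
      have conj_pow: "(inv y \<otimes> x \<otimes> y) [^] k = inv y \<otimes> x [^] k \<otimes> y" for k :: nat
        using xy yc by (induction k) (simp_all add: m_assoc)
      have pow: "(x \<otimes> z) [^] n = x [^] n"
        unfolding xz conj_pow using comm xy yc by (simp add: m_assoc)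
      have "x [^] n \<otimes> (x \<otimes> z) = (x \<otimes> z) \<otimes> x [^] n"
        using pow nat_pow_comm[of "x \<otimes> z" n 1] xy z by simp
      also have "x [^] n \<otimes> (x \<otimes> z) = x \<otimes> (x [^] n \<otimes> z)"
        using xy z nat_pow_comm[of x n 1] by (simp flip: m_assoc)
      finally have "x [^] n \<otimes> z = z \<otimes> x [^] n"
        using xy z by (simp add: m_assoc)
      then have "x \<otimes> z = z \<otimes> x" using step z by blast
      then have "(x \<otimes> z) [^] n = x [^] n \<otimes> z [^] n"
        using xy z pow_mult_distrib by blast
      then have "z [^] n = \<one>" using pow xy z by (simp add: l_cancel_one)
      then have "z = \<one>" using torsion_free xy z by blast
      then show "x \<otimes> y = y \<otimes> x"
        using xz xy yc by (metis inv_solve_left m_assoc m_closed inv_closed r_one)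
    qed
  qed
  from this[of 0] show ?thesis using C xy by auto
qed

end

section \<open>Isolators and polynomial functions\<close>

context group
begin

lemma commutator_eq_one_iff:
  assumes "x \<in> carrier G" "y \<in> carrier G"
  shows "cmt x y = \<one> \<longleftrightarrow> x \<otimes> y = y \<otimes> x"
proof
  assume "cmt x y = \<one>"
  then have "y \<otimes> (x \<otimes> cmt x y) = y \<otimes> x" using assms by simp
  then show "x \<otimes> y = y \<otimes> x" using assms by (simp add: m_assoc)
next
  assume "x \<otimes> y = y \<otimes> x"
  then have "cmt x y = inv x \<otimes> inv y \<otimes> (y \<otimes> x)" using assms by (simp add: m_assoc)
  then show "cmt x y = \<one>" using assms by (simp add: m_assoc)
qed

lemma lcs_subset_isolator: "lcs G k \<subseteq> isolator G (lcs G k)"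
proof
  fix x assume x: "x \<in> lcs G k"
  then have "x [^] (1::nat) \<in> lcs G k" using lcs_carrier by simp
  then show "x \<in> isolator G (lcs G k)" using x lcs_carrier unfolding isolator_def by blast
qed

lemma isolator_normal:
  assumes "subgroup (isolator G (lcs G k)) G"
  shows "isolator G (lcs G k) \<lhd> G"
proof (rule normal_invI[OF assms])
  fix g h assume g: "g \<in> carrier G" and "h \<in> isolator G (lcs G k)"
  then obtain n where h: "h \<in> carrier G" "n > 0" "h [^] (n::nat) \<in> lcs G k"
    by (auto simp: isolator_def)
  have "(g \<otimes> h \<otimes> inv g) [^] n = g \<otimes> h [^] n \<otimes> inv g" for n :: nat
    using g h by (induction n) (simp_all add: m_assoc)
  then have "(g \<otimes> h \<otimes> inv g) [^] n \<in> lcs G k"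
    using g h by (simp add: normal.inv_op_closed2[OF lcs_normal])
  then show "g \<otimes> h \<otimes> inv g \<in> isolator G (lcs G k)"
    using g h unfolding isolator_def by blast
qed

lemma isolator_isolated:
  assumes "g \<in> carrier G" "n > 0" "g [^] (n::nat) \<in> isolator G H"
  shows "g \<in> isolator G H"
proof -
  obtain m where "m > 0" "(g [^] n) [^] (m::nat) \<in> H"
    using assms by (auto simp: isolator_def)
  then have "n * m > 0" "g [^] (n * m) \<in> H"
    using assms by (simp_all add: nat_pow_pow)
  then show ?thesis using assms(1) unfolding isolator_def by blast
qed

text \<open>Modulo the isolator, powers of \<open>x\<close> and \<open>y\<close> commute, and
  \<open>isolated_commutation\<close> removes the two exponents one after the other. That the
  isolator is a subgroup is assumed here; later it is a term of the Mal'cev series.\<close>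

lemma isolator_commutator:
  assumes sub: "subgroup (isolator G (lcs G (Suc (i + j)))) G"
    and nil: "lcs G m = {\<one>}"
    and x: "x \<in> isolator G (lcs G i)" and y: "y \<in> isolator G (lcs G j)"
  shows "cmt x y \<in> isolator G (lcs G (Suc (i + j)))"
proof -
  define N where "N = isolator G (lcs G (Suc (i + j)))"
  have N: "N \<lhd> G" unfolding N_def by (rule isolator_normal[OF sub])
  then have subN: "subgroup N G" by (rule normal_imp_subgroup)
  define Q where "Q = G Mod N"
  define \<phi> where "\<phi> = (\<lambda>a. N #> a)"
  interpret Q: group Q unfolding Q_def by (rule normal.factorgroup_is_group[OF N])
  interpret hom: group_hom G Q \<phi>
    unfolding Q_def \<phi>_def
    by (intro group_hom.intro group_hom_axioms.intro normal.factorgroup_is_group[OF N]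
        normal.r_coset_hom_Mod[OF N] is_group)
  have kernel: "\<phi> a = \<one>\<^bsub>Q\<^esub> \<longleftrightarrow> a \<in> N" if "a \<in> carrier G" for a
    using that subN coset_join1[of N a] coset_join2[of a N] subgroup.subset[OF subN]
    by (auto simp: Q_def \<phi>_def)
  have surj: "\<exists>g \<in> carrier G. q = \<phi> g" if "q \<in> carrier Q" for q
    using that by (auto simp: Q_def \<phi>_def carrier_FactGroup)
  have \<phi>_cmt: "\<phi> (cmt a b) = Q.cmt (\<phi> a) (\<phi> b)" if "a \<in> carrier G" "b \<in> carrier G" for a b
    using that by simp
  \<comment> \<open>The quotient is torsion-free because \<open>N\<close> contains all roots of its
    elements.\<close>
  have tf: "q = \<one>\<^bsub>Q\<^esub>" if q: "q \<in> carrier Q" and n: "n > 0" "q [^]\<^bsub>Q\<^esub> (n::nat) = \<one>\<^bsub>Q\<^esub>" for q n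
  proof -
    obtain g where g: "g \<in> carrier G" "q = \<phi> g" using surj q by blast
    then have "g [^] n \<in> N" using n kernel[of "g [^] n"] by (simp add: hom.hom_nat_pow)
    then have "g \<in> N" using g n isolator_isolated unfolding N_def by blast
    then show ?thesis using g kernel by simp
  qed
  have commute: "a \<otimes>\<^bsub>Q\<^esub> b = b \<otimes>\<^bsub>Q\<^esub> a"
    if "a \<in> carrier Q" "b \<in> carrier Q" "n > 0"
      "a [^]\<^bsub>Q\<^esub> (n::nat) \<otimes>\<^bsub>Q\<^esub> b = b \<otimes>\<^bsub>Q\<^esub> a [^]\<^bsub>Q\<^esub> n" for a b n
  proof (rule Q.isolated_commutation[where C = "\<lambda>k. \<phi> ` lcs G k" and m = m, OF tf _ _ _ _ that])
    show "\<phi> ` lcs G 0 = carrier Q" using surj by auto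
    show "\<phi> ` lcs G m = {\<one>\<^bsub>Q\<^esub>}" using nil by simp
    show "\<phi> ` lcs G k \<subseteq> carrier Q" for k using lcs_carrier by auto
    fix k p q assume "p \<in> carrier Q" "q \<in> \<phi> ` lcs G k"
    then obtain g h where gh: "p = \<phi> g" "g \<in> carrier G" "q = \<phi> h" "h \<in> lcs G k"
      using surj by blast
    then have "Q.cmt p q = \<phi> (cmt g h)" using \<phi>_cmt lcs_carrier by simp
    then show "Q.cmt p q \<in> \<phi> ` lcs G (Suc k)"
      using lcs_commutator'[of g h k] gh by blast
  qed auto
  obtain n where n: "x \<in> carrier G" "n > 0" "x [^] (n::nat) \<in> lcs G i"
    using x by (auto simp: isolator_def)
  obtain k where k: "y \<in> carrier G" "k > 0" "y [^] (k::nat) \<in> lcs G j"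
    using y by (auto simp: isolator_def)
  have "cmt (x [^] n) (y [^] k) \<in> N"
    using lcs_lcs_commutator[OF n(3) k(3)] lcs_subset_isolator unfolding N_def by blast
  then have "\<phi> (cmt (x [^] n) (y [^] k)) = \<one>\<^bsub>Q\<^esub>"
    using n k by (subst kernel) simp_all
  then have "Q.cmt (\<phi> x [^]\<^bsub>Q\<^esub> n) (\<phi> y [^]\<^bsub>Q\<^esub> k) = \<one>\<^bsub>Q\<^esub>"
    using n k by (simp add: hom.hom_nat_pow)
  then have "\<phi> x [^]\<^bsub>Q\<^esub> n \<otimes>\<^bsub>Q\<^esub> \<phi> y [^]\<^bsub>Q\<^esub> k = \<phi> y [^]\<^bsub>Q\<^esub> k \<otimes>\<^bsub>Q\<^esub> \<phi> x [^]\<^bsub>Q\<^esub> n"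
    using n k by (subst (asm) Q.commutator_eq_one_iff) auto
  then have "\<phi> x \<otimes>\<^bsub>Q\<^esub> \<phi> y [^]\<^bsub>Q\<^esub> k = \<phi> y [^]\<^bsub>Q\<^esub> k \<otimes>\<^bsub>Q\<^esub> \<phi> x"
    using n k by (intro commute[of "\<phi> x" _ n]) auto
  then have "\<phi> y \<otimes>\<^bsub>Q\<^esub> \<phi> x = \<phi> x \<otimes>\<^bsub>Q\<^esub> \<phi> y"
    using n k by (intro commute[of "\<phi> y" _ k]) auto
  then have "\<phi> (cmt x y) = \<one>\<^bsub>Q\<^esub>"
    using n k \<phi>_cmt Q.commutator_eq_one_iff[of "\<phi> x" "\<phi> y"] by simp
  then have "cmt x y \<in> N" using n k by (subst (asm) kernel) simp_all
  then show ?thesis unfolding N_def .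
qed

end

section \<open>Strongly central filtrations and polynomial functions on them\<close>

locale filtered_group = group +
  fixes I :: "nat \<Rightarrow> 'a set"
  assumes I_subgroup: "w \<ge> 1 \<Longrightarrow> subgroup (I w) G"
    and I_1: "I (Suc 0) = carrier G"
    and I_antimono: "1 \<le> v \<Longrightarrow> v \<le> w \<Longrightarrow> I w \<subseteq> I v"
    and I_commutator: "v \<ge> 1 \<Longrightarrow> w \<ge> 1 \<Longrightarrow> x \<in> I v \<Longrightarrow> y \<in> I w \<Longrightarrow> cmt x y \<in> I (v + w)"
begin

text \<open>Right translation is chosen because \<open>fun_act\<close> also moves the argument on
  the right; degree bounds thus survive the action.\<close>

definition diff :: "'a \<Rightarrow> ('a \<Rightarrow> rat) \<Rightarrow> 'a \<Rightarrow> rat" where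
  "diff g f = (\<lambda>h. f (h \<otimes> g) - f h)"

text \<open>\<open>poly_on N m f\<close> says that every product of differences of total weight at least \<open>m\<close>
  kills \<open>f\<close> on \<open>N\<close>; the truncated subtraction \<open>m - w\<close> is intended.\<close>

inductive poly_on :: "'a set \<Rightarrow> nat \<Rightarrow> ('a \<Rightarrow> rat) \<Rightarrow> bool" for N where
  zero: "(\<And>h. h \<in> N \<Longrightarrow> f h = 0) \<Longrightarrow> poly_on N 0 f"
| step: "m > 0 \<Longrightarrow> (\<And>w g. w \<ge> 1 \<Longrightarrow> g \<in> N \<Longrightarrow> g \<in> I w \<Longrightarrow> poly_on N (m - w) (diff g f))
    \<Longrightarrow> poly_on N m f"

lemma poly_on_0: "poly_on N 0 f \<longleftrightarrow> (\<forall>h \<in> N. f h = 0)"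
  by (subst poly_on.simps) auto

lemma poly_on_pos:
  "m > 0 \<Longrightarrow> poly_on N m f \<longleftrightarrow> (\<forall>w \<ge> 1. \<forall>g \<in> N \<inter> I w. poly_on N (m - w) (diff g f))"
  by (subst poly_on.simps) auto

context
  fixes N
  assumes N: "subgroup N G"
begin

lemma N_mult: "g \<in> N \<Longrightarrow> h \<in> N \<Longrightarrow> g \<otimes> h \<in> N"
  by (rule subgroup.m_closed[OF N])

lemma poly_on_cong:
  "poly_on N m f \<Longrightarrow> (\<And>h. h \<in> N \<Longrightarrow> f h = f' h) \<Longrightarrow> poly_on N m f'"
proof (induction m arbitrary: f f' rule: less_induct)
  case (less m)
  show ?case
  proof (cases "m = 0")
    case True
    then show ?thesis using less.prems by (simp add: poly_on_0)
  next
    case False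
    show ?thesis
    proof (rule poly_on.step)
      fix w g assume wg: "w \<ge> 1" "g \<in> N" "g \<in> I w"
      then have "poly_on N (m - w) (diff g f)" using less.prems False by (simp add: poly_on_pos)
      then show "poly_on N (m - w) (diff g f')"
        by (rule less.IH[rotated]) (use wg False less.prems N_mult in \<open>auto simp: diff_def\<close>)
    qed (use False in simp)
  qed
qed

lemma poly_on_zero: "(\<And>h. h \<in> N \<Longrightarrow> f h = 0) \<Longrightarrow> poly_on N m f"
proof (induction m arbitrary: f rule: less_induct)
  case (less m)
  then show ?case
    by (cases "m = 0") (auto simp: poly_on_0 poly_on_pos diff_def N_mult)
qed

lemma poly_on_diff:
  assumes "poly_on N m f" "w \<ge> 1" "g \<in> N" "g \<in> I w"
  shows "poly_on N (m - w) (diff g f)"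
  using assms by (cases "m = 0") (auto simp: poly_on_0 poly_on_pos diff_def N_mult)

lemma poly_on_mono: "poly_on N m f \<Longrightarrow> m \<le> m' \<Longrightarrow> poly_on N m' f"
proof (induction m' arbitrary: m f rule: less_induct)
  case (less m')
  show ?case
  proof (cases "m = 0")
    case True
    then show ?thesis using less.prems by (simp add: poly_on_0 poly_on_zero)
  next
    case False
    show ?thesis
    proof (rule poly_on.step)
      fix w g assume "w \<ge> 1" "g \<in> N" "g \<in> I w"
      then have "poly_on N (m - w) (diff g f)" using less.prems poly_on_diff by simp
      then show "poly_on N (m' - w) (diff g f)"
        using less.IH[of "m' - w" "m - w"] less.prems False \<open>w \<ge> 1\<close> by simp
    qed (use False less.prems in simp)
  qed
qed

lemma poly_on_lin:
  "poly_on N m f \<Longrightarrow> poly_on N m f' \<Longrightarrow> poly_on N m (\<lambda>h. a * f h + b * f' h)"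
proof (induction m arbitrary: f f' rule: less_induct)
  case (less m)
  show ?case
  proof (cases "m = 0")
    case True
    then show ?thesis using less.prems by (simp add: poly_on_0)
  next
    case False
    show ?thesis
    proof (rule poly_on.step)
      fix w g assume wg: "w \<ge> 1" "g \<in> N" "g \<in> I w"
      have "poly_on N (m - w) (\<lambda>h. a * diff g f h + b * diff g f' h)"
        using wg False by (intro less.IH poly_on_diff less.prems) auto
      then show "poly_on N (m - w) (diff g (\<lambda>h. a * f h + b * f' h))"
        by (simp add: diff_def algebra_simps)
    qed (use False in simp)
  qed
qed

lemma poly_on_add: "poly_on N m f \<Longrightarrow> poly_on N m f' \<Longrightarrow> poly_on N m (\<lambda>h. f h + f' h)"
  using poly_on_lin[of m f f' 1 1] by simp

lemma poly_on_const: "m > 0 \<Longrightarrow> poly_on N m (\<lambda>_. k)"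
  by (simp add: poly_on_pos diff_def poly_on_zero)

lemma poly_on_translate:
  assumes "N \<subseteq> carrier G" "poly_on N m f" "g \<in> N"
  shows "poly_on N m (\<lambda>h. f (h \<otimes> g))"
proof -
  have "poly_on N (m - 1) (diff g f)"
    using assms by (intro poly_on_diff) (auto simp: I_1)
  then have "poly_on N m (diff g f)" by (rule poly_on_mono) simp
  from poly_on_add[OF assms(2) this] show ?thesis by (simp add: diff_def)
qed

text \<open>Writing \<open>x\<^sup>-\<^sup>1 g x = g u\<close>, the commutator \<open>u\<close> has weight at least \<open>v\<close> more than \<open>g\<close>, so
  conjugation by \<open>x\<close> is the identity up to terms of degree lower by \<open>v\<close>.\<close>

lemma poly_on_conj:
  assumes x: "x \<in> I v" "v \<ge> 1" and norm: "\<And>n. n \<in> N \<Longrightarrow> inv x \<otimes> n \<otimes> x \<in> N"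
  shows "poly_on N m f \<Longrightarrow> poly_on N (m - v) (\<lambda>n. f (inv x \<otimes> n \<otimes> x) - f n)"
proof (induction m arbitrary: f rule: less_induct)
  case (less m)
  let ?c = "\<lambda>n. inv x \<otimes> n \<otimes> x"
  have xc: "x \<in> carrier G" by (rule subgroup.mem_carrier[OF I_subgroup[OF x(2)] x(1)])
  have Nc: "n \<in> carrier G" if "n \<in> N" for n using that by (rule subgroup.mem_carrier[OF N])
  have u: "\<exists>u. u \<in> N \<and> u \<in> I (w + v) \<and> ?c n = n \<otimes> u" if "n \<in> N" "n \<in> I w" "w \<ge> 1" for n w
  proof (intro exI conjI)
    have "cmt n x = inv n \<otimes> ?c n" using Nc that xc by (simp add: m_assoc)
    then show "cmt n x \<in> N" using that(1) norm by (simp add: N_mult subgroup.m_inv_closed[OF N])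
    show "cmt n x \<in> I (w + v)" using that x by (intro I_commutator)
    show "?c n = n \<otimes> cmt n x" using Nc that xc by (simp add: m_assoc)
  qed
  show ?case
  proof (cases "m \<le> v")
    case True
    have "f (?c n) - f n = 0" if n: "n \<in> N" for n
    proof -
      obtain u where u: "u \<in> N" "u \<in> I (1 + v)" "?c n = n \<otimes> u"
        using u[of n 1] n Nc by (auto simp: I_1)
      have "poly_on N (m - (1 + v)) (diff u f)"
        using u less.prems by (intro poly_on_diff) auto
      then have "diff u f n = 0" using True n by (simp add: poly_on_0)
      then show ?thesis using u(3) by (simp add: diff_def)
    qed
    then show ?thesis by (rule poly_on_zero)
  next
    case False
    show ?thesis
    proof (rule poly_on.step)
      fix w g assume wg: "w \<ge> 1" "g \<in> N" "g \<in> I w"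
      obtain u where u: "u \<in> N" "u \<in> I (w + v)" "?c g = g \<otimes> u" using u[of g w] wg by blast
      have cg: "?c g \<in> N" "?c g \<in> I w"
        using norm wg u I_antimono[of w "w + v"] subgroup.m_closed[OF I_subgroup[of w]]
        by (auto simp: N_mult)
      \<comment> \<open>The difference of \<open>f (?c n) - f n\<close> along \<open>g\<close>
        splits into the same expression for \<open>diff (?c g) f\<close>, whose bound is smaller by
        \<open>w\<close>, and the remainder
        \<open>f (n \<otimes> g \<otimes> u) - f (n \<otimes> g)\<close>.\<close>
      have 1: "poly_on N (m - w - v) (\<lambda>n. diff (?c g) f (?c n) - diff (?c g) f n)"
        using wg cg False less.prems by (intro less.IH poly_on_diff) auto
      have "poly_on N (m - (w + v)) (diff u f)"
        using u wg less.prems by (intro poly_on_diff) auto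
      then have 2: "poly_on N (m - w - v) (\<lambda>n. diff u f (n \<otimes> g))"
        using poly_on_translate[of _ "diff u f" g] wg Nc by auto
      have "poly_on N (m - w - v) (diff g (\<lambda>n. f (?c n) - f n))"
      proof (rule poly_on_cong[OF poly_on_add[OF 1 2]])
        fix n assume n: "n \<in> N"
        have "?c (n \<otimes> g) = ?c n \<otimes> ?c g"
          using n wg Nc xc by (simp add: m_assoc)
        moreover have "n \<otimes> g \<otimes> u = n \<otimes> ?c g"
          using n wg u Nc by (simp add: m_assoc)
        ultimately show "diff (?c g) f (?c n) - diff (?c g) f n + diff u f (n \<otimes> g)
            = diff g (\<lambda>n. f (?c n) - f n) n"
          by (simp add: diff_def)
      qed
      then show "poly_on N (m - v - w) (diff g (\<lambda>n. f (?c n) - f n))"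
        by (simp add: add.commute)
    qed (use False in simp)
  qed
qed

end

text \<open>Climbs one step of the Mal'cev series. \<open>F\<close> ignores powers of
  \<open>x\<close>, and so do its differences, which closes the induction on \<open>m\<close>. On
  \<open>N\<close>, a difference along \<open>x [^] b \<otimes> n'\<close> is the effect of
  conjugating by \<open>x [^] b\<close>, controlled by \<open>poly_on_conj\<close>, plus a
  difference along \<open>n'\<close>; \<open>weight\<close> ensures that both factors have the
  weight of the product.\<close>

lemma poly_on_extend:
  assumes N: "subgroup N G" and M: "subgroup M G" and NM: "N \<subseteq> M" and x: "x \<in> M"
    and decomp: "\<And>g. g \<in> M \<Longrightarrow> \<exists>b n. n \<in> N \<and> g = x [^] (b::int) \<otimes> n"
    and norm: "\<And>n b. n \<in> N \<Longrightarrow> inv (x [^] (b::int)) \<otimes> n \<otimes> x [^] b \<in> N"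
    and weight: "\<And>w. w \<ge> 1 \<Longrightarrow> M \<inter> I w \<subseteq> N \<or> x \<in> I w"
  shows "poly_on N m F \<Longrightarrow> (\<And>a n. n \<in> N \<Longrightarrow> F (x [^] (a::int) \<otimes> n) = F n) \<Longrightarrow> poly_on M m F"
proof (induction m arbitrary: F rule: less_induct)
  case (less m)
  have xc: "x \<in> carrier G" by (rule subgroup.mem_carrier[OF M x])
  have Nc: "n \<in> carrier G" if "n \<in> N" for n using that by (rule subgroup.mem_carrier[OF N])
  show ?case
  proof (cases "m = 0")
    case True
    have "F g = 0" if g: "g \<in> M" for g
    proof -
      obtain b n where "n \<in> N" "g = x [^] (b::int) \<otimes> n" using decomp g by blast
      then show ?thesis using less.prems True by (simp add: poly_on_0)
    qed
    then show ?thesis using True by (simp add: poly_on_0)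
  next
    case False
    show ?thesis
    proof (rule poly_on.step)
      fix w g assume wg: "w \<ge> 1" "g \<in> M" "g \<in> I w"
      obtain b n' where g: "n' \<in> N" "g = x [^] (b::int) \<otimes> n'" 
        and xb: "x [^] b \<in> I w" and n': "n' \<in> I w"
      proof (cases "g \<in> N")
        case True
        show ?thesis
          using that[of g 0] True wg Nc subgroup.one_closed[OF I_subgroup[of w]] by simp
      next
        case gN: False
        then have xw: "x \<in> I w" using weight[of w] wg by blast
        obtain b n' where g: "n' \<in> N" "g = x [^] (b::int) \<otimes> n'" using decomp wg by blast
        have xb: "x [^] b \<in> I w"
          using subgroup_int_pow_closed[OF I_subgroup xw] wg by simp
        have "n' = inv (x [^] b) \<otimes> g" using g Nc xc by simp
        then have "n' \<in> I w"
          using xb wg I_subgroup[of w] by (simp add: subgroup.m_closed subgroup.m_inv_closed)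
        then show ?thesis using that g xb by blast
      qed
      let ?c = "\<lambda>n. inv (x [^] b) \<otimes> n \<otimes> x [^] b"
      \<comment> \<open>Moving \<open>x [^] b\<close> to the left past \<open>n\<close> conjugates
        \<open>n\<close>. The result does not involve \<open>a\<close>, so \<open>diff g F\<close>
        again ignores powers of \<open>x\<close>.\<close>
      have D: "diff g F (x [^] (a::int) \<otimes> n) = F (?c n \<otimes> n') - F n" if n: "n \<in> N" for a n
      proof -
        have "x [^] a \<otimes> n \<otimes> g = x [^] (a + b) \<otimes> (?c n \<otimes> n')"
          using g n Nc xc by (simp add: m_assoc int_pow_mult)
        then show ?thesis
          using less.prems(2) n g(1) norm by (simp add: diff_def subgroup.m_closed[OF N])
      qed
      have D0: "diff g F n = F (?c n \<otimes> n') - F n" if n: "n \<in> N" for n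
        using D[OF n, of 0] n Nc by simp
      have "poly_on N m (\<lambda>n. F (n \<otimes> n'))"
        using Nc g less.prems by (intro poly_on_translate[OF N]) auto
      then have "poly_on N (m - w) (\<lambda>n. F (?c n \<otimes> n') - F (n \<otimes> n'))"
        using poly_on_conj[OF N xb wg(1), of m "\<lambda>n. F (n \<otimes> n')"] norm by blast
      moreover have "poly_on N (m - w) (diff n' F)"
        using g n' wg less.prems by (intro poly_on_diff[OF N]) auto
      ultimately have "poly_on N (m - w) (diff g F)"
        by (rule poly_on_cong[OF N poly_on_add[OF N]]) (simp add: D0, simp add: diff_def)
      then show "poly_on M (m - w) (diff g F)"
        using wg False D D0 by (intro less.IH) auto
    qed (use False in simp)
  qed
qed

lemma poly_on_1_const:
  assumes "poly_on (carrier G) 1 f" "g \<in> carrier G"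
  shows "f g = f \<one>"
proof -
  have "poly_on (carrier G) (1 - 1) (diff g f)"
    using assms by (intro poly_on_diff subgroup_self) (auto simp: I_1)
  then have "diff g f \<one> = 0" by (simp add: poly_on_0)
  then show ?thesis using assms by (simp add: diff_def)
qed

text \<open>Discrete integration: appending a letter \<open>s\<close> changes \<open>f\<close> by
  \<open>diff s f\<close>, of degree lower by one, and the bounds are summed along the word.\<close>

lemma poly_on_word_bound:
  assumes S: "finite S" "S \<subseteq> carrier G" and f: "poly_on (carrier G) (Suc m) f"
  shows "\<exists>C \<ge> 0. \<forall>ws. set ws \<subseteq> S \<longrightarrow>
    \<bar>f (foldr (\<otimes>) ws \<one>)\<bar> \<le> C * (1 + of_nat (length ws)) ^ m"
  using f
proof (induction m arbitrary: f)
  case 0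
  have "foldr (\<otimes>) ws \<one> \<in> carrier G" if "set ws \<subseteq> S" for ws
    using that S by (induction ws) auto
  then have "f (foldr (\<otimes>) ws \<one>) = f \<one>" if "set ws \<subseteq> S" for ws
    using 0 that poly_on_1_const by simp
  then show ?case by (intro exI[of _ "\<bar>f \<one>\<bar>"]) auto
next
  case (Suc m)
  have closed: "foldr (\<otimes>) ws \<one> \<in> carrier G" if "set ws \<subseteq> S" for ws
    using that S by (induction ws) auto
  have snoc: "foldr (\<otimes>) (ws @ [s]) \<one> = foldr (\<otimes>) ws \<one> \<otimes> s" if "set ws \<subseteq> S" "s \<in> S" for ws s
    using that S closed by (induction ws) (auto simp: m_assoc subset_iff)
  have "\<exists>C \<ge> 0. \<forall>ws. set ws \<subseteq> S \<longrightarrow>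
    \<bar>diff s f (foldr (\<otimes>) ws \<one>)\<bar> \<le> C * (1 + of_nat (length ws)) ^ m" if "s \<in> S" for s
  proof (rule Suc.IH)
    have "poly_on (carrier G) (Suc (Suc m) - 1) (diff s f)"
      using Suc.prems that S by (intro poly_on_diff subgroup_self) (auto simp: I_1)
    then show "poly_on (carrier G) (Suc m) (diff s f)" by simp
  qed
  then obtain C where C: "\<And>s. s \<in> S \<Longrightarrow> C s \<ge> 0"
    "\<And>s ws. s \<in> S \<Longrightarrow> set ws \<subseteq> S \<Longrightarrow>
      \<bar>diff s f (foldr (\<otimes>) ws \<one>)\<bar> \<le> C s * (1 + of_nat (length ws)) ^ m"
    by metis
  \<comment> \<open>One constant for all letters that also covers the empty word.\<close>
  define B where "B = sum C S + \<bar>f \<one>\<bar>"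
  have CB: "C s \<le> B" if "s \<in> S" for s
    using member_le_sum[of s S C] that C(1) S(1) unfolding B_def by auto
  have B0: "B \<ge> 0" using C(1) unfolding B_def by (simp add: sum_nonneg)
  have "\<bar>f (foldr (\<otimes>) ws \<one>)\<bar> \<le> B * (1 + of_nat (length ws)) ^ Suc m" if "set ws \<subseteq> S" for ws
    using that
  proof (induction ws rule: rev_induct)
    case Nil
    then show ?case using C(1) by (simp add: B_def sum_nonneg)
  next
    case (snoc s ws)
    let ?l = "of_nat (length ws) :: rat"
    have ws: "set ws \<subseteq> S" "s \<in> S" using snoc.prems by auto
    have "f (foldr (\<otimes>) (ws @ [s]) \<one>) = f (foldr (\<otimes>) ws \<one>) + diff s f (foldr (\<otimes>) ws \<one>)"
      using \<open>set ws \<subseteq> S \<Longrightarrow> s \<in> S \<Longrightarrow> foldr (\<otimes>) (ws @ [s]) \<one> = foldr (\<otimes>) ws \<one> \<otimes> s\<close> ws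
      by (simp add: diff_def)
    then have "\<bar>f (foldr (\<otimes>) (ws @ [s]) \<one>)\<bar>
        \<le> \<bar>f (foldr (\<otimes>) ws \<one>)\<bar> + \<bar>diff s f (foldr (\<otimes>) ws \<one>)\<bar>" by linarith
    also have "\<dots> \<le> B * (1 + ?l) ^ Suc m + C s * (1 + ?l) ^ m"
      using snoc.IH ws C(2) by (intro add_mono) auto
    also have "\<dots> \<le> B * (1 + ?l) ^ Suc m + B * (1 + ?l) ^ m"
      using CB ws by (intro add_left_mono mult_right_mono) auto
    also have "\<dots> = B * ((2 + ?l) * (1 + ?l) ^ m)" by (simp add: algebra_simps)
    also have "\<dots> \<le> B * ((2 + ?l) * (2 + ?l) ^ m)"
      using B0 by (intro mult_left_mono power_mono) auto
    finally show ?case by (simp add: algebra_simps)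
  qed
  then show ?case using B0 by blast
qed

end

lemma (in filtered_group) poly_on_sum:
  assumes "subgroup N G" "finite J" "\<And>j. j \<in> J \<Longrightarrow> poly_on N m (f j)"
  shows "poly_on N m (\<lambda>h. \<Sum>j\<in>J. a j * f j h)"
  using assms(2,3)
proof (induction J rule: finite_induct)
  case empty
  then show ?case by (simp add: poly_on_zero[OF assms(1)])
next
  case (insert j J)
  then show ?case
    using poly_on_lin[OF assms(1), of m "f j" "\<lambda>h. \<Sum>j\<in>J. a j * f j h" "a j" 1] by simp
qed

section \<open>Mal'cev coordinates\<close>

lemma word_prod_simps [simp]:
  "word_prod G [] as = \<one>\<^bsub>G\<^esub>" "word_prod G xs [] = \<one>\<^bsub>G\<^esub>"
  "word_prod G (x # xs) (a # as) = x [^]\<^bsub>G\<^esub> a \<otimes>\<^bsub>G\<^esub> word_prod G xs as"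
  by (simp_all add: word_prod_def)

lemma (in group) word_prod_closed: "set xs \<subseteq> carrier G \<Longrightarrow> word_prod G xs as \<in> carrier G"
  by (induction xs as rule: list_induct2') auto

lemma (in group) word_prod_replicate_zero:
  "set xs \<subseteq> carrier G \<Longrightarrow> i \<le> length xs \<Longrightarrow>
    word_prod G xs (replicate i 0 @ as) = word_prod G (drop i xs) as"
proof (induction i arbitrary: xs)
  case (Suc i)
  then obtain y ys where "xs = y # ys" by (cases xs) auto
  moreover from this have "set (drop i ys) \<subseteq> carrier G"
    using Suc.prems set_drop_subset[of i ys] by auto
  ultimately show ?case using Suc word_prod_closed[of "drop i ys" as] by simp
qed simp

locale malcev_group = group +
  fixes xs :: "'a list"
  assumes nil: "nilpotent_group G" and tf: "torsion_free G" and basis: "nickel_malcev_basis G xs"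
begin

abbreviation M :: "nat \<Rightarrow> 'a set" where "M \<equiv> malcev_series G xs"

abbreviation c :: nat where "c \<equiv> nilpotency_class G"

abbreviation Iso :: "nat \<Rightarrow> 'a set" where "Iso w \<equiv> isolator G (lower_central G w)"

lemma xs_carrier: "set xs \<subseteq> carrier G"
  using basis by (simp add: nickel_malcev_basis_def)

lemma M_0: "M 0 = carrier G"
  using basis by (simp add: nickel_malcev_basis_def)

lemma M_normal: "i < length xs \<Longrightarrow> g \<in> M i \<Longrightarrow> n \<in> M (Suc i) \<Longrightarrow> g \<otimes> n \<otimes> inv g \<in> M (Suc i)"
  using basis by (auto simp: nickel_malcev_basis_def)

lemma M_cyclic:
  "i < length xs \<Longrightarrow> g \<in> M i \<Longrightarrow> \<exists>!n::int. inv ((xs ! i) [^] n) \<otimes> g \<in> M (Suc i)"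
  using basis by (auto simp: nickel_malcev_basis_def)

lemma M_subgroup: "subgroup (M i) G"
  unfolding malcev_series_def
  by (rule generate_is_subgroup) (use xs_carrier in \<open>auto dest: in_set_dropD\<close>)

lemma M_carrier: "g \<in> M i \<Longrightarrow> g \<in> carrier G"
  by (rule subgroup.mem_carrier[OF M_subgroup])

lemma M_antimono: "i \<le> j \<Longrightarrow> M j \<subseteq> M i"
  unfolding malcev_series_def by (intro mono_generate set_drop_subset_set_drop)

lemma M_length: "M (length xs) = {\<one>}"
  by (simp add: malcev_series_def generate_empty)

lemma nth_in_M: "i < length xs \<Longrightarrow> xs ! i \<in> M i"
  unfolding malcev_series_def by (intro generate.incl) (auto simp: Cons_nth_drop_Suc[symmetric])

lemma nth_pow_in_M: "i < length xs \<Longrightarrow> (xs ! i) [^] (b::int) \<in> M i"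
  by (rule subgroup_int_pow_closed[OF M_subgroup nth_in_M])

lemma lcs_class: "lcs G c = {\<one>}"
  using nil LeastI_ex[of "\<lambda>c. lower_central G (Suc c) = {\<one>}"]
  by (simp add: nilpotent_group_def nilpotency_class_def lower_central_def)

lemma lcs_trivial: "c \<le> k \<Longrightarrow> lcs G k = {\<one>}"
  using lcs_antimono[of c k] lcs_class subgroup.one_closed[OF lcs_subgroup[of k]] by auto

text \<open>The basis supplies this up to weight \<open>Suc c\<close>; beyond it the lower central
  terms are all trivial.\<close>

lemma Iso_series: 
  assumes "w \<ge> 1"
  shows "\<exists>i \<le> length xs. M i = Iso w"
proof (cases "w \<le> Suc c")
  case True
  then show ?thesis using basis assms by (auto simp: nickel_malcev_basis_def)
next
  case False
  then have "lower_central G w = lower_central G (Suc c)"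
    by (simp add: lower_central_def lcs_trivial)
  then show ?thesis using basis by (auto simp: nickel_malcev_basis_def)
qed

lemma Iso_subgroup: "w \<ge> 1 \<Longrightarrow> subgroup (Iso w) G"
  by (drule Iso_series, elim exE conjE) (erule subst, rule M_subgroup)

lemma Iso_trivial:
  assumes "w > c"
  shows "Iso w = {\<one>}"
proof -
  have lc: "lower_central G w = {\<one>}" using assms by (simp add: lower_central_def lcs_trivial)
  have "\<one> \<in> Iso w" using assms by (intro subgroup.one_closed[OF Iso_subgroup]) simp
  moreover have "g = \<one>" if "g \<in> Iso w" for g
    using that tf unfolding isolator_def lc torsion_free_def by blast
  ultimately show ?thesis by blast
qed

lemma Iso_antimono: "v \<le> w \<Longrightarrow> Iso w \<subseteq> Iso v"
  using lcs_antimono[of "v - 1" "w - 1"] unfolding isolator_def lower_central_def by fastforce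

sublocale filtered_group G Iso
proof (intro filtered_group.intro filtered_group_axioms.intro is_group)
  show "Iso (Suc 0) = carrier G"
    using lcs_subset_isolator[of 0] by (auto simp: lower_central_def isolator_def)
  fix v w x y assume vw: "1 \<le> v" "1 \<le> w" "x \<in> Iso v" "y \<in> Iso w"
  have *: "v + w - 1 = Suc ((v - 1) + (w - 1))" using vw by simp
  show "cmt x y \<in> Iso (v + w)"
    unfolding lower_central_def *
  proof (rule isolator_commutator[OF _ lcs_class])
    show "subgroup (isolator G (lcs G (Suc (v - 1 + (w - 1))))) G"
      using Iso_subgroup[of "v + w"] vw unfolding lower_central_def * by simp
  qed (use vw in \<open>auto simp: lower_central_def\<close>)
qed (simp_all add: Iso_subgroup Iso_antimono)

section \<open>Exponents along the Mal'cev series\<close>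

lemma M_decomp:
  assumes i: "i < length xs" and g: "g \<in> M i"
  shows "\<exists>b n. n \<in> M (Suc i) \<and> g = (xs ! i) [^] (b::int) \<otimes> n"
proof -
  obtain b :: int where "inv ((xs ! i) [^] b) \<otimes> g \<in> M (Suc i)"
    using M_cyclic[OF assms] by blast
  moreover have "g = (xs ! i) [^] b \<otimes> (inv ((xs ! i) [^] b) \<otimes> g)"
    using M_carrier[OF g] i xs_carrier by (simp add: subset_iff)
  ultimately show ?thesis by blast
qed

lemma word_prod_in_M: "i \<le> length xs \<Longrightarrow> word_prod G (drop i xs) as \<in> M i"
proof (induction arbitrary: as rule: inc_induct)
  case base
  show ?case by (simp add: M_length)
next
  case (step i)
  show ?case
  proof (cases as)
    case Nil
    then show ?thesis using subgroup.one_closed[OF M_subgroup] by simp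
  next
    case (Cons a as')
    then show ?thesis
      using step M_antimono[of i "Suc i"] nth_pow_in_M[of i a]
      by (auto simp: Cons_nth_drop_Suc[symmetric] intro!: subgroup.m_closed[OF M_subgroup])
  qed
qed

lemma malcev_coords_unique:
  "i \<le> length xs \<Longrightarrow> g \<in> M i \<Longrightarrow>
    \<exists>!as. length as = length xs - i \<and> g = word_prod G (drop i xs) as"
proof (induction arbitrary: g rule: inc_induct)
  case base
  then show ?case by (simp add: M_length)
next
  case (step i)
  have dr: "drop i xs = xs ! i # drop (Suc i) xs" using step by (simp add: Cons_nth_drop_Suc)
  have xc: "xs ! i \<in> carrier G" using step xs_carrier by auto
  have len: "length xs - i = Suc (length xs - Suc i)" using step by simp
  obtain b n where bn: "n \<in> M (Suc i)" "g = (xs ! i) [^] (b::int) \<otimes> n"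
    using M_decomp step by blast
  obtain as where as: "length as = length xs - Suc i" "n = word_prod G (drop (Suc i) xs) as"
    using step.IH[OF bn(1)] by blast
  show ?case
  proof (rule ex1I[of _ "b # as"])
    show "length (b # as) = length xs - i \<and> g = word_prod G (drop i xs) (b # as)"
      using as bn len dr by simp
  next
    fix bs assume bs: "length bs = length xs - i \<and> g = word_prod G (drop i xs) bs"
    then obtain b' as' where b': "bs = b' # as'" using len by (cases bs) auto
    let ?n' = "word_prod G (drop (Suc i) xs) as'"
    have n': "?n' \<in> M (Suc i)" using step by (intro word_prod_in_M) simp
    have g': "g = (xs ! i) [^] b' \<otimes> ?n'" using bs b' dr by simp
    have "inv ((xs ! i) [^] b') \<otimes> g = ?n'"
      unfolding g' using M_carrier[OF n'] xc by simp
    moreover have "inv ((xs ! i) [^] b) \<otimes> g = n"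
      unfolding bn(2) using M_carrier[OF bn(1)] xc by simp
    ultimately have "b' = b" using M_cyclic[of i g] step.hyps step.prems n' bn(1) by auto
    then have "?n' = n" using g' bn M_carrier[OF n'] M_carrier[OF bn(1)] xc by simp
    then have "as' = as" using step.IH[OF bn(1)] as bs b' len by auto
    then show "bs = b # as" using b' \<open>b' = b\<close> by simp
  qed
qed

lemma malcev_coord_word_prod:
  assumes ij: "i \<le> j" "j < length xs" and as: "length as = length xs - i"
  shows "malcev_coord G xs j (word_prod G (drop i xs) as) = of_int (as ! (j - i))"
proof -
  let ?g = "word_prod G (drop i xs) as"
  have g: "?g \<in> carrier G" by (rule M_carrier[OF word_prod_in_M]) (use ij in simp)
  have "?g = word_prod G xs (replicate i 0 @ as)"
    using word_prod_replicate_zero xs_carrier ij by simp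
  then have "(THE as. length as = length xs \<and> ?g = word_prod G xs as) = replicate i 0 @ as"
    using malcev_coords_unique[of 0 ?g] g as ij by (intro the1_equality) (auto simp: M_0)
  then show ?thesis using g ij by (simp add: malcev_coord_def nth_append)
qed

lemma malcev_coord_lead:
  assumes "j < length xs" "n \<in> M (Suc j)"
  shows "malcev_coord G xs j ((xs ! j) [^] (a::int) \<otimes> n) = of_int a"
proof -
  obtain as where "length as = length xs - Suc j" "n = word_prod G (drop (Suc j) xs) as"
    using malcev_coords_unique[of "Suc j" n] assms by auto
  then show ?thesis using malcev_coord_word_prod[of j j "a # as"] assms
    by (simp add: Cons_nth_drop_Suc[symmetric])
qed

lemma malcev_coord_tail:
  assumes "i < j" "j < length xs" "n \<in> M (Suc i)"
  shows "malcev_coord G xs j ((xs ! i) [^] (a::int) \<otimes> n) = malcev_coord G xs j n"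
proof -
  obtain as where as: "length as = length xs - Suc i" "n = word_prod G (drop (Suc i) xs) as"
    using malcev_coords_unique[of "Suc i" n] assms by auto
  have "malcev_coord G xs j (word_prod G (drop i xs) (a # as)) = of_int ((a # as) ! (j - i))"
    using assms as by (intro malcev_coord_word_prod) auto
  moreover have "malcev_coord G xs j n = of_int (as ! (j - Suc i))"
    using assms as malcev_coord_word_prod[of "Suc i" j as] by simp
  moreover have "(a # as) ! (j - i) = as ! (j - Suc i)"
    using assms by (simp add: nth_Cons')
  ultimately show ?thesis using assms as by (simp add: Cons_nth_drop_Suc[symmetric])
qed

lemma malcev_coords_separate:
  assumes g: "g \<in> carrier G" and h: "h \<in> carrier G"
    and eq: "\<And>j. j < length xs \<Longrightarrow> malcev_coord G xs j g = malcev_coord G xs j h"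
  shows "g = h"
proof -
  obtain as bs where as: "length as = length xs" "g = word_prod G xs as"
    and bs: "length bs = length xs" "h = word_prod G xs bs"
    using malcev_coords_unique[of 0 g] malcev_coords_unique[of 0 h] g h by (auto simp: M_0)
  have "as ! j = bs ! j" if "j < length xs" for j
    using that eq[OF that] malcev_coord_word_prod[of 0 j as] malcev_coord_word_prod[of 0 j bs] as bs
    by simp
  then have "as = bs" using as bs by (simp add: nth_equalityI)
  then show ?thesis using as bs by simp
qed

text \<open>On \<open>M j\<close> the coordinate is a homomorphism to the integers, so its
  differences are constant. Each step up from \<open>M (Suc i)\<close> to \<open>M i\<close> adds a
  factor \<open>xs ! i\<close> that the coordinate ignores, so \<open>poly_on_extend\<close>
  applies.\<close>

lemma malcev_coord_poly:
  assumes j: "j < length xs"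
  shows "poly_on (carrier G) (Suc c) (malcev_coord G xs j)"
proof -
  let ?t = "malcev_coord G xs j"
  have "poly_on (M i) (Suc c) ?t" if "i \<le> j" for i
    using that
  proof (induction rule: inc_induct)
    case base
    show ?case
    proof (rule poly_on.step)
      fix w g assume wg: "1 \<le> w" "g \<in> M j" "g \<in> Iso w"
      show "poly_on (M j) (Suc c - w) (diff g ?t)"
      \<comment> \<open>The constant difference is admissible only if \<open>Suc c - w\<close> is
        positive; for larger \<open>w\<close> the element \<open>g\<close> is trivial.\<close>
      proof (cases "w > c")
        case True
        then have "g = \<one>" using wg Iso_trivial by auto
        then show ?thesis
          by (intro poly_on_zero[OF M_subgroup]) (simp add: diff_def M_carrier)
      next
        case False
        obtain b n' where g: "n' \<in> M (Suc j)" "g = (xs ! j) [^] (b::int) \<otimes> n'"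
          using M_decomp j wg by blast
        have "of_int b = diff g ?t h" if h: "h \<in> M j" for h
        proof -
          obtain a n where h: "n \<in> M (Suc j)" "h = (xs ! j) [^] (a::int) \<otimes> n"
            using M_decomp j h by blast
          let ?n = "inv ((xs ! j) [^] b) \<otimes> n \<otimes> (xs ! j) [^] b"
          have xc: "xs ! j \<in> carrier G" using j xs_carrier by auto
          have "?n \<in> M (Suc j)"
            using M_normal[OF j nth_pow_in_M[OF j, of "- b"] h(1)] xc by (simp add: int_pow_neg)
          then have n: "?n \<otimes> n' \<in> M (Suc j)"
            by (rule subgroup.m_closed[OF M_subgroup _ g(1)])
          have "h \<otimes> g = (xs ! j) [^] (a + b) \<otimes> (?n \<otimes> n')"
            using xc h g M_carrier by (simp add: m_assoc int_pow_mult)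
          then have "?t (h \<otimes> g) = of_int (a + b)"
            using malcev_coord_lead[OF j n] by simp
          moreover have "?t h = of_int a" using malcev_coord_lead[OF j h(1)] h(2) by simp
          ultimately show ?thesis by (simp add: diff_def)
        qed
        then show ?thesis
          using False by (intro poly_on_cong[OF M_subgroup poly_on_const[OF M_subgroup]]) auto
      qed
    qed simp
  next
    case (step i)
    have i: "i < length xs" using step j by simp
    show ?case
    proof (rule poly_on_extend[OF M_subgroup M_subgroup])
      show "M (Suc i) \<subseteq> M i" by (simp add: M_antimono)
      show "xs ! i \<in> M i" using i by (rule nth_in_M)
      show "\<exists>b n. n \<in> M (Suc i) \<and> g = (xs ! i) [^] (b::int) \<otimes> n" if "g \<in> M i" for g
        using M_decomp i that by blast
      show "inv ((xs ! i) [^] b) \<otimes> n \<otimes> (xs ! i) [^] b \<in> M (Suc i)" if "n \<in> M (Suc i)" for n and b :: int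
        using M_normal[OF i nth_pow_in_M[OF i, of "- b"] that] i xs_carrier
        by (simp add: int_pow_neg subset_iff)
      \<comment> \<open>As a term of the series, \<open>Iso w\<close> either contains
        \<open>xs ! i\<close> or is contained in \<open>M (Suc i)\<close>.\<close>
      show "M i \<inter> Iso w \<subseteq> M (Suc i) \<or> xs ! i \<in> Iso w" if w: "1 \<le> w" for w
      proof -
        obtain k where k: "M k = Iso w" using Iso_series[OF w] by blast
        show ?thesis
        proof (cases "k \<le> i")
          case True
          then show ?thesis using k nth_in_M[OF i] M_antimono[of k i] by blast
        next
          case False
          then show ?thesis using k M_antimono[of "Suc i" k] by auto
        qed
      qed
      show "poly_on (M (Suc i)) (Suc c) ?t" using step by simp
      show "?t ((xs ! i) [^] a \<otimes> n) = ?t n" if "n \<in> M (Suc i)" for a :: int and n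
        using malcev_coord_tail step j that by simp
    qed
  qed
  from this[of 0] show ?thesis by (simp add: M_0)
qed

text \<open>A difference of weight \<open>c\<close> lowers the bound \<open>Suc c\<close> to 1,
  which leaves a constant.\<close>

lemma central_translate:
  assumes f: "poly_on (carrier G) (Suc c) f" and h: "h \<in> Iso c" and c: "c \<ge> 1" and g: "g \<in> carrier G"
  shows "f (g \<otimes> h) = f g + (f h - f \<one>)"
proof -
  have hc: "h \<in> carrier G" using h by (simp add: isolator_def)
  have "poly_on (carrier G) (Suc c - c) (diff h f)"
    using f h hc c by (intro poly_on_diff subgroup_self) auto
  then have "diff h f g = diff h f \<one>" using poly_on_1_const g by simp
  then show ?thesis using hc by (simp add: diff_def)
qed

lemma central_pow:
  assumes f: "poly_on (carrier G) (Suc c) f" and h: "h \<in> Iso c" and c: "c \<ge> 1"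
  shows "f (h [^] (n::nat)) = f \<one> + of_nat n * (f h - f \<one>)"
proof (induction n)
  case (Suc n)
  have "h \<in> carrier G" using h by (simp add: isolator_def)
  then have "f (h [^] Suc n) = f (h [^] n) + (f h - f \<one>)"
    using central_translate[OF f h c, of "h [^] n"] by simp
  then show ?case using Suc by (simp add: algebra_simps)
qed simp

end

section \<open>Words and unitriangular matrices\<close>

text \<open>The \<open>LEAST\<close> in \<open>word_length\<close> says nothing if no word exists;
  \<open>word_le\<close> carries the existence along and works with upper bounds.\<close>

definition word_le :: "('a, 'b) monoid_scheme \<Rightarrow> 'a set \<Rightarrow> nat \<Rightarrow> 'a \<Rightarrow> bool" where
  "word_le K S n h \<longleftrightarrow> (\<exists>ws. length ws \<le> n \<and> set ws \<subseteq> S \<union> m_inv K ` S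
     \<and> foldr (\<otimes>\<^bsub>K\<^esub>) ws \<one>\<^bsub>K\<^esub> = h)"

lemma word_le_mono: "word_le K S n h \<Longrightarrow> n \<le> m \<Longrightarrow> word_le K S m h"
  unfolding word_le_def by (elim exE conjE, intro exI conjI) auto

lemma word_le_one: "word_le K S n \<one>\<^bsub>K\<^esub>"
  unfolding word_le_def by (rule exI[of _ "[]"]) simp

lemma word_length_attained:
  assumes "word_le K S n h"
  shows "word_le K S (word_length K S h) h" "word_length K S h \<le> n"
proof -
  let ?P = "\<lambda>n. \<exists>ws. length ws = n \<and> set ws \<subseteq> S \<union> m_inv K ` S \<and> foldr (\<otimes>\<^bsub>K\<^esub>) ws \<one>\<^bsub>K\<^esub> = h"
  obtain ws where w: "length ws \<le> n" "set ws \<subseteq> S \<union> m_inv K ` S" "foldr (\<otimes>\<^bsub>K\<^esub>) ws \<one>\<^bsub>K\<^esub> = h"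
    using assms unfolding word_le_def by blast
  have ws: "?P (length ws)" by (intro exI[of _ ws] conjI w refl)
  show "word_le K S (word_length K S h) h"
    using LeastI[of ?P, OF ws] unfolding word_le_def word_length_def by (metis order_refl)
  show "word_length K S h \<le> n"
    using Least_le[of ?P, OF ws] w(1) unfolding word_length_def by linarith
qed

text \<open>\<open>Max\<close> bounds its elements only on a finite set. The ball is finite because
  there are finitely many short words; \<open>rep\<close> excludes elements of \<open>H\<close>
  without any word.\<close>

lemma word_length_le_distortion:
  assumes fin: "finite SK" and rep: "\<And>k. k \<in> H \<Longrightarrow> \<exists>m. word_le K SK m k"
    and h: "h \<in> H" "word_le K SK n h"
  shows "word_length K SH h \<le> distortion K SK H SH n"
  unfolding distortion_def
proof (rule Max_ge)
  let ?A = "SK \<union> m_inv K ` SK"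
  have "{word_length K SH h |h. h \<in> H \<and> word_length K SK h \<le> n}
    \<subseteq> (\<lambda>ws. word_length K SH (foldr (\<otimes>\<^bsub>K\<^esub>) ws \<one>\<^bsub>K\<^esub>)) ` {ws. set ws \<subseteq> ?A \<and> length ws \<le> n}"
  proof safe
    fix k assume k: "k \<in> H" "word_length K SK k \<le> n"
    then obtain m where "word_le K SK m k" using rep by blast
    then have "word_le K SK n k" by (rule word_le_mono[OF word_length_attained(1) k(2)])
    then obtain ws where ws: "length ws \<le> n" "set ws \<subseteq> ?A" "foldr (\<otimes>\<^bsub>K\<^esub>) ws \<one>\<^bsub>K\<^esub> = k"
      unfolding word_le_def by blast
    show "word_length K SH k
      \<in> (\<lambda>ws. word_length K SH (foldr (\<otimes>\<^bsub>K\<^esub>) ws \<one>\<^bsub>K\<^esub>)) ` {ws. set ws \<subseteq> ?A \<and> length ws \<le> n}"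
      by (rule image_eqI[of _ _ ws]) (use ws in simp_all)
  qed
  moreover have "finite {ws. set ws \<subseteq> ?A \<and> length ws \<le> n}"
    using fin by (intro finite_lists_length_le) simp
  ultimately show "finite {word_length K SH h |h. h \<in> H \<and> word_length K SK h \<le> n}"
    by (rule finite_surj[rotated])
  show "word_length K SH h \<in> {word_length K SH h |h. h \<in> H \<and> word_length K SK h \<le> n}"
    using h(1) word_length_attained(2)[OF h(2)] by blast
qed

lemma (in monoid) word_le_mult:
  assumes "S \<union> m_inv G ` S \<subseteq> carrier G" "word_le G S m g" "word_le G S n h"
  shows "word_le G S (m + n) (g \<otimes> h)"
proof -
  obtain us vs where us: "length us \<le> m" "set us \<subseteq> S \<union> m_inv G ` S" "foldr (\<otimes>) us \<one> = g"
    and vs: "length vs \<le> n" "set vs \<subseteq> S \<union> m_inv G ` S" "foldr (\<otimes>) vs \<one> = h"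
    using assms(2,3) unfolding word_le_def by blast
  have closed: "foldr (\<otimes>) ws \<one> \<in> carrier G" if "set ws \<subseteq> S \<union> m_inv G ` S" for ws
    using that by (induction ws) (use assms(1) in auto)
  have "foldr (\<otimes>) (us @ vs) \<one> = foldr (\<otimes>) us \<one> \<otimes> foldr (\<otimes>) vs \<one>"
    using us(2)
  proof (induction us)
    case Nil
    then show ?case using closed[OF vs(2)] by simp
  next
    case (Cons u us)
    then have "u \<in> carrier G" "foldr (\<otimes>) us \<one> \<in> carrier G"
      using assms(1) closed[of us] by auto
    then show ?case using Cons closed[OF vs(2)] by (simp add: m_assoc)
  qed
  then show ?thesis
    unfolding word_le_def using us vs by (intro exI[of _ "us @ vs"]) auto
qed

lemma (in monoid) generate_word_le:
  assumes S: "S \<union> m_inv G ` S \<subseteq> carrier G" and g: "g \<in> generate G S"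
  shows "\<exists>n. word_le G S n g"
  using g
proof (induction rule: generate.induct)
  case one
  then show ?case using word_le_one by blast
next
  case (incl h)
  then show ?case
    unfolding word_le_def using S by (intro exI[of _ 1] exI[of _ "[h]"]) auto
next
  case (inv h)
  then show ?case
    unfolding word_le_def using S by (intro exI[of _ 1] exI[of _ "[inv h]"]) auto
next
  case (eng h1 h2)
  then show ?case using word_le_mult[OF S] by blast
qed

text \<open>For \<open>k \<ge> 1\<close> this is the k-th term of the lower central series of the
  unitriangular group.\<close>

definition unitri :: "nat \<Rightarrow> nat \<Rightarrow> int mat \<Rightarrow> bool" where
  "unitri d k A \<longleftrightarrow> A \<in> carrier_mat d d \<and>
     (\<forall>i < d. \<forall>j < d. j < i + k \<longrightarrow> A $$ (i, j) = of_bool (i = j))"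

lemma carrier_UT: "carrier (UT d) = {A. unitri d 1 A}"
proof (rule equalityI; rule subsetI)
  fix A assume A: "A \<in> carrier (UT d)"
  have "A $$ (i, j) = of_bool (i = j)" if "i < d" "j < i + 1" for i j
    using A that by (cases "i = j") (auto simp: UT_def)
  then show "A \<in> {A. unitri d 1 A}" using A by (auto simp: UT_def unitri_def)
next
  fix A assume "A \<in> {A. unitri d 1 A}"
  then show "A \<in> carrier (UT d)" by (auto simp: UT_def unitri_def)
qed

lemma mult_UT [simp]: "A \<otimes>\<^bsub>UT d\<^esub> B = A * B"
  and one_UT [simp]: "\<one>\<^bsub>UT d\<^esub> = 1\<^sub>m d"
  by (simp_all add: UT_def)

lemma index_mult_mat_sum:
  fixes A B :: "int mat"
  assumes "A \<in> carrier_mat d d" "B \<in> carrier_mat d d" "i < d" "j < d"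
  shows "(A * B) $$ (i, j) = (\<Sum>k<d. A $$ (i, k) * B $$ (k, j))"
  using assms by (auto simp: scalar_prod_def lessThan_atLeast0 intro!: sum.cong)

text \<open>Entrywise form of AB - 1 = (A-1) + (B-1) + (A-1)(B-1); in the last product the numbers
  of vanishing superdiagonals add up.\<close>

lemma index_mult_mat_unipotent:
  fixes A B :: "int mat"
  assumes "A \<in> carrier_mat d d" "B \<in> carrier_mat d d" "i < d" "j < d"
  shows "(A * B) $$ (i, j) = A $$ (i, j) + B $$ (i, j) - of_bool (i = j)
    + (\<Sum>k<d. (A $$ (i, k) - of_bool (i = k)) * (B $$ (k, j) - of_bool (k = j)))"
proof -
  have "(\<Sum>k<d. (A $$ (i, k) - of_bool (i = k)) * (B $$ (k, j) - of_bool (k = j)))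
    = (\<Sum>k<d. A $$ (i, k) * B $$ (k, j)) - (\<Sum>k<d. of_bool (i = k) * B $$ (k, j))
      - (\<Sum>k<d. A $$ (i, k) * of_bool (k = j)) + (\<Sum>k<d. of_bool (i = k) * of_bool (k = j))"
    by (simp add: algebra_simps sum.distrib sum_subtractf)
  also have "(\<Sum>k<d. of_bool (i = k) * B $$ (k, j)) = B $$ (i, j)"
    using assms by (simp add: of_bool_def if_distrib[of "\<lambda>x. x * _"] cong: if_cong)
  also have "(\<Sum>k<d. A $$ (i, k) * of_bool (k = j)) = A $$ (i, j)"
    using assms by (simp add: of_bool_def if_distrib[of "\<lambda>x. _ * x"] cong: if_cong)
  also have "(\<Sum>k<d. of_bool (i = k) * of_bool (k = j)) = (of_bool (i = j) :: int)"
    using assms by (simp add: of_bool_def if_distrib[of "\<lambda>x. x * _"] cong: if_cong)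
  finally show ?thesis using index_mult_mat_sum[OF assms] by simp
qed

lemma unitri_product_zero:
  assumes "unitri d k A" "unitri d l B" "i < d" "j < d" "j < i + k + l"
  shows "(\<Sum>m<d. (A $$ (i, m) - of_bool (i = m)) * (B $$ (m, j) - of_bool (m = j))) = 0"
proof (rule sum.neutral, safe)
  fix m assume "m < d"
  then show "(A $$ (i, m) - of_bool (i = m)) * (B $$ (m, j) - of_bool (m = j)) = 0"
    using assms by (cases "m < i + k") (auto simp: unitri_def)
qed

lemma unitri_mult:
  assumes "unitri d k A" "unitri d k B" "k \<ge> 1"
  shows "unitri d k (A * B)"
proof -
  have carr: "A \<in> carrier_mat d d" "B \<in> carrier_mat d d" using assms by (auto simp: unitri_def)
  have "(A * B) $$ (i, j) = of_bool (i = j)" if "i < d" "j < d" "j < i + k" for i j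
    using that assms unitri_product_zero[OF assms(1,2), of i j] index_mult_mat_unipotent[OF carr, of i j]
    by (auto simp: unitri_def)
  then show ?thesis using carr by (auto simp: unitri_def)
qed

text \<open>With \<open>Z\<close> the inverse of \<open>Y * X\<close>, the product is the commutator
  of \<open>X\<close> and \<open>Y\<close>. Below superdiagonal \<open>k + 1\<close> the matrices
  \<open>X * Y\<close> and \<open>Y * X\<close> agree, as both products of nilpotent parts vanish
  there, and the upper triangular \<open>Z\<close> preserves this.\<close>

lemma unitri_commutator:
  assumes X: "unitri d k X" and Y: "unitri d 1 Y" and Z: "unitri d 1 Z"
    and inverse: "Z * (Y * X) = 1\<^sub>m d"
  shows "unitri d (Suc k) (Z * (X * Y))"
proof -
  have carr: "X \<in> carrier_mat d d" "Y \<in> carrier_mat d d" "Z \<in> carrier_mat d d"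
    using assms by (auto simp: unitri_def)
  then have XY: "X * Y \<in> carrier_mat d d" and YX: "Y * X \<in> carrier_mat d d" by auto
  have comm: "(X * Y) $$ (i, j) = (Y * X) $$ (i, j)" if "i < d" "j < d" "j < i + Suc k" for i j
    using that unitri_product_zero[OF X Y, of i j] unitri_product_zero[OF Y X, of i j]
      index_mult_mat_unipotent[OF carr(1,2)] index_mult_mat_unipotent[OF carr(2,1)] by simp
  have "(Z * (X * Y)) $$ (i, j) = of_bool (i = j)" if ij: "i < d" "j < d" "j < i + Suc k" for i j
  proof -
    have "(Z * (X * Y)) $$ (i, j) = (\<Sum>l<d. Z $$ (i, l) * (X * Y) $$ (l, j))"
      using carr XY ij by (intro index_mult_mat_sum)
    also have "\<dots> = (\<Sum>l<d. Z $$ (i, l) * (Y * X) $$ (l, j))"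
    proof (rule sum.cong)
      fix l assume l: "l \<in> {..<d}"
      show "Z $$ (i, l) * (X * Y) $$ (l, j) = Z $$ (i, l) * (Y * X) $$ (l, j)"
      proof (cases "l < i")
        case True
        then show ?thesis using Z l ij by (simp add: unitri_def)
      next
        case False
        then show ?thesis using comm[of l j] l ij by simp
      qed
    qed simp
    also have "\<dots> = (Z * (Y * X)) $$ (i, j)"
      using carr YX ij by (intro index_mult_mat_sum[symmetric])
    finally show ?thesis using inverse ij by simp
  qed
  then show ?thesis using carr XY by (auto simp: unitri_def)
qed

lemma unitri_inverse:
  assumes A: "unitri d k A" and B: "unitri d 1 B" and AB: "A * B = 1\<^sub>m d"
  shows "unitri d k B"
proof -
  have carr: "A \<in> carrier_mat d d" "B \<in> carrier_mat d d" using A B by (auto simp: unitri_def)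
  have "B $$ (i, j) = of_bool (i = j)" if ij: "i < d" "j < d" "j < i + k" for i j
  proof -
    have "of_bool (i = j) = A $$ (i, j) + B $$ (i, j) - of_bool (i = j)"
      using index_mult_mat_unipotent[OF carr ij(1,2)] unitri_product_zero[OF A B ij(1,2)] ij AB
      by (cases "i = j") simp_all
    then show ?thesis using A ij by (simp add: unitri_def)
  qed
  then show ?thesis using carr by (simp add: unitri_def)
qed

lemma monoid_UT: "Group.monoid (UT d)"
proof
  show "x \<otimes>\<^bsub>UT d\<^esub> y \<in> carrier (UT d)" if "x \<in> carrier (UT d)" "y \<in> carrier (UT d)" for x y
    using that unitri_mult[of d 1] by (simp add: carrier_UT)
qed (auto simp: carrier_UT unitri_def)

section \<open>Elementary matrices and short words\<close>

lemma addrow_mat_UT: "i < j \<Longrightarrow> addrow_mat d a i j \<in> carrier (UT d)"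
  by (auto simp: carrier_UT unitri_def)

lemma addrow_mat_add:
  fixes a b :: int
  assumes "i < j" "j < d"
  shows "addrow_mat d a i j * addrow_mat d b i j = addrow_mat d (a + b) i j"
  using assms by (subst addrow_mat[symmetric, of _ _ d]) (auto intro!: eq_matI)

text \<open>The source of the distortion: parameters multiply while word lengths only add. Negated
  parameters give the inverses.\<close>

lemma addrow_mat_commutator:
  fixes a b :: int
  assumes "i < k" "k < j" "j < d"
  shows "addrow_mat d a i k * (addrow_mat d b k j * (addrow_mat d (- a) i k * addrow_mat d (- b) k j))
    = addrow_mat d (a * b) i j"
proof -
  have "addrow a i k (addrow b k j (addrow (- a) i k (addrow_mat d (- b) k j))) = addrow_mat d (a * b) i j"
    using assms by (auto intro!: eq_matI)
  then show ?thesis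
    using assms by (simp add: addrow_mat[symmetric, of _ d d])
qed

text \<open>For \<open>q = d - 1 - c\<close> the free entries are those of the last column strictly
  beyond the c-th superdiagonal.\<close>

definition last_col_mat :: "nat \<Rightarrow> nat \<Rightarrow> (nat \<Rightarrow> int) \<Rightarrow> int mat" where
  "last_col_mat d q v = mat d d (\<lambda>(i, j). if i = j then 1 else if Suc j = d \<and> i < q then v i else 0)"

lemma last_col_mat_Suc:
  assumes "Suc q < d"
  shows "last_col_mat d (Suc q) v = addrow_mat d (v q) q (d - 1) * last_col_mat d q v"
  using assms by (subst addrow_mat[symmetric, of _ _ d]) (auto simp: last_col_mat_def intro!: eq_matI)

context
  fixes d :: nat and S :: "int mat set"
  assumes gen: "generate (UT d) S = carrier (UT d)"
begin

text \<open>\<open>generate\<close> contains the inverse letters by definition, so the monoid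
  structure of \<open>UT d\<close> suffices for handling words.\<close>

lemma UT_letters: "S \<union> m_inv (UT d) ` S \<subseteq> carrier (UT d)"
  using gen generate.incl[of _ S "UT d"] generate.inv[of _ S "UT d"] by auto

lemma word_le_UT_mult:
  "word_le (UT d) S m A \<Longrightarrow> word_le (UT d) S n B \<Longrightarrow> word_le (UT d) S (m + n) (A * B)"
  using monoid.word_le_mult[OF monoid_UT UT_letters] by simp

lemma word_le_addrow_scale:
  assumes "i < j" "j < d" "word_le (UT d) S L (addrow_mat d a i j)"
  shows "word_le (UT d) S (n * L) (addrow_mat d (int n * a) i j)"
proof (induction n)
  case 0
  have "addrow_mat d (0::int) i j = 1\<^sub>m d" using assms by (intro eq_matI) auto
  then show ?case using word_le_one[of "UT d" S 0] by simp
next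
  case (Suc n)
  show ?case
    using word_le_UT_mult[OF assms(3) Suc] assms by (simp add: addrow_mat_add algebra_simps)
qed

text \<open>Both signs are provided because commutators also consume inverses.\<close>

lemma word_le_addrow_superdiagonal:
  assumes "i + 1 < d" "m \<le> 1"
  shows "\<exists>C. \<forall>n \<ge> 1. \<forall>s \<in> {1, -1}. word_le (UT d) S (C * n) (addrow_mat d (s * int n ^ m) i (i + 1))"
proof -
  have "\<exists>n. word_le (UT d) S n (addrow_mat d s i (i + 1))" for s
    by (rule monoid.generate_word_le[OF monoid_UT UT_letters]) (simp add: gen addrow_mat_UT)
  then obtain L where L: "\<And>s. word_le (UT d) S (L s) (addrow_mat d s i (i + 1))" by metis
  define C where "C = L 1 + L (- 1)"
  have C: "word_le (UT d) S C (addrow_mat d s i (i + 1))" if "s \<in> {1, -1}" for s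
    using that L[of s] word_le_mono[of "UT d" S _ _ C] unfolding C_def by auto
  have "word_le (UT d) S (C * n) (addrow_mat d (s * int n ^ m) i (i + 1))"
    if n: "n \<ge> 1" and s: "s \<in> {1, -1}" for n s
  proof (cases "m = 0")
    case True
    then show ?thesis using C[OF s] word_le_mono[of "UT d" S C _ "C * n"] n by simp
  next
    case False
    then have "m = 1" using assms by simp
    then show ?thesis
      using word_le_addrow_scale[OF _ _ C[OF s], of n] assms by (simp add: mult.commute)
  qed
  then show ?thesis by blast
qed

text \<open>A commutator with a matrix on the first superdiagonal moves one superdiagonal further
  and raises the exponent by at most one; four factors of length O(n) keep the length O(n).\<close>

lemma word_le_addrow_pow:
  assumes "p \<ge> 1" "i + p < d" "m \<le> p"
  shows "\<exists>C. \<forall>n \<ge> 1. \<forall>s \<in> {1, -1}. word_le (UT d) S (C * n) (addrow_mat d (s * int n ^ m) i (i + p))"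
  using assms
proof (induction p arbitrary: i m rule: nat_induct_at_least)
  case base
  then show ?case by (intro word_le_addrow_superdiagonal)
next
  case (Suc p)
  \<comment> \<open>For \<open>m = 0\<close> the truncated \<open>m - 1\<close> is 0 already, so the
    second factor must then contribute n^0.\<close>
  define e where "e = (if m = 0 then 0 else 1 :: nat)"
  have mp: "m - 1 \<le> p" "i + p < d" using Suc.prems by auto
  have ep: "i + p + 1 < d" "e \<le> 1" using Suc.prems by (auto simp: e_def)
  have m: "m = (m - 1) + e" by (simp add: e_def)
  obtain C1 where C1: "\<forall>n \<ge> 1. \<forall>s \<in> {1, -1}.
      word_le (UT d) S (C1 * n) (addrow_mat d (s * int n ^ (m - 1)) i (i + p))"
    using Suc.IH[OF mp(2,1)] by blast
  obtain C2 where C2: "\<forall>n \<ge> 1. \<forall>s \<in> {1, -1}.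
      word_le (UT d) S (C2 * n) (addrow_mat d (s * int n ^ e) (i + p) (i + p + 1))"
    using word_le_addrow_superdiagonal[OF ep] by blast
  have "word_le (UT d) S ((C1 + (C2 + (C1 + C2))) * n) (addrow_mat d (s * int n ^ m) i (i + Suc p))"
    if n: "n \<ge> 1" and s: "s \<in> {1, -1}" for n s
  proof -
    have s': "- s \<in> {1, -1}" using s by auto
    have "word_le (UT d) S (C1 * n + (C2 * n + (C1 * n + C2 * n)))
      (addrow_mat d (s * int n ^ (m - 1)) i (i + p) * (addrow_mat d (1 * int n ^ e) (i + p) (i + p + 1) *
       (addrow_mat d (- s * int n ^ (m - 1)) i (i + p) * addrow_mat d (- 1 * int n ^ e) (i + p) (i + p + 1))))"
      by (intro word_le_UT_mult C1[rule_format] C2[rule_format] n s s') auto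
    moreover have "int n ^ m = int n ^ (m - 1) * int n ^ e"
      by (subst m) (simp add: power_add)
    ultimately show ?thesis
      using addrow_mat_commutator[of i "i + p" "i + p + 1" d "s * int n ^ (m - 1)" "int n ^ e"] Suc
      by (simp add: algebra_simps)
  qed
  then show ?case by blast
qed

text \<open>One elementary factor per row. Row \<open>k\<close> meets the last column on
  superdiagonal \<open>d - 1 - k\<close>, at least \<open>e\<close>, where n^e costs O(n); the
  coefficients \<open>a k\<close> affect only the constant.\<close>

lemma word_le_last_col:
  assumes "q < d" "\<And>k. k < q \<Longrightarrow> k + e < d" "e \<ge> 1"
  shows "\<exists>C. \<forall>n \<ge> 1. word_le (UT d) S (C * n) (last_col_mat d q (\<lambda>k. a k * int n ^ e))"
  using assms(1,2)
proof (induction q)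
  case 0
  have "last_col_mat d 0 v = 1\<^sub>m d" for v by (auto simp: last_col_mat_def intro!: eq_matI)
  then show ?case using word_le_one[of "UT d" S] by simp
next
  case (Suc q)
  obtain C1 where C1: "\<And>n. n \<ge> 1 \<Longrightarrow> word_le (UT d) S (C1 * n) (last_col_mat d q (\<lambda>k. a k * int n ^ e))"
    using Suc by auto
  have q: "q + (d - 1 - q) = d - 1" "e \<le> d - 1 - q" "d - 1 - q \<ge> 1"
    using Suc.prems(1) Suc.prems(2)[of q] by auto
  obtain C2 where C2: "\<forall>n \<ge> 1. \<forall>s \<in> {1, -1}.
      word_le (UT d) S (C2 * n) (addrow_mat d (s * int n ^ e) q (d - 1))"
    using word_le_addrow_pow[of "d - 1 - q" q e] q Suc.prems(1) by auto
  define s N where "s = (if a q < 0 then -1 else 1 :: int)" and "N = nat \<bar>a q\<bar>"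
  have sN: "a q = int N * s" "s \<in> {1, -1}" by (auto simp: s_def N_def)
  have "word_le (UT d) S ((N * C2 + C1) * n) (last_col_mat d (Suc q) (\<lambda>k. a k * int n ^ e))"
    if n: "n \<ge> 1" for n
  proof -
    have "word_le (UT d) S (N * (C2 * n)) (addrow_mat d (int N * (s * int n ^ e)) q (d - 1))"
      using Suc.prems by (intro word_le_addrow_scale C2[rule_format] n sN) auto
    from word_le_UT_mult[OF this C1[OF n]] show ?thesis
      using Suc.prems sN by (simp add: last_col_mat_Suc algebra_simps)
  qed
  then show ?case by blast
qed

end

section \<open>The Nickel representation\<close>

locale nickel_group = malcev_group +
  fixes fs :: "('a \<Rightarrow> rat) list"
  assumes fs_basis: "nickel_basis G xs fs"
begin

abbreviation d :: nat where "d \<equiv> length fs"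

abbreviation A :: "'a \<Rightarrow> int mat" where "A \<equiv> nickel_map G fs"

lemma module_vanishes: "f \<in> nickel_module G xs \<Longrightarrow> x \<notin> carrier G \<Longrightarrow> f x = 0"
  by (auto simp: nickel_module_def lincomb_def fun_act_def split_def)

lemma fs_module: "j < d \<Longrightarrow> fs ! j \<in> nickel_module G xs"
  using fs_basis nth_mem unfolding nickel_basis_def by blast

lemma fs_independent:
  assumes "\<And>x. (\<Sum>k<d. a k * (fs ! k) x) = (\<Sum>k<d. b k * (fs ! k) x)" "k < d"
  shows "a k = b k"
proof -
  let ?cs = "map (\<lambda>k. a k - b k) [0..<d]"
  have "lincomb ?cs fs = (\<lambda>_. 0)"
    using assms(1) by (auto simp: lincomb_def algebra_simps sum_subtractf)
  then have "\<forall>c \<in> set ?cs. c = 0"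
    using fs_basis unfolding nickel_basis_def by (metis length_map length_upt minus_nat.diff_0)
  then show ?thesis using assms(2) by auto
qed

lemma fs_int_unique:
  assumes "length cs = d" "length cs' = d"
    "lincomb (map rat_of_int cs) fs = lincomb (map of_int cs') fs"
  shows "cs = cs'"
proof (rule nth_equalityI)
  fix k assume k: "k < length cs"
  have "rat_of_int (cs ! k) = of_int (cs' ! k)"
  proof (rule fs_independent)
    show "(\<Sum>k<d. rat_of_int (cs ! k) * (fs ! k) x) = (\<Sum>k<d. of_int (cs' ! k) * (fs ! k) x)" for x
      using fun_cong[OF assms(3), of x] assms(1,2) by (simp add: lincomb_def)
  qed (use k assms in simp)
  then show "cs ! k = cs' ! k" by simp
qed (use assms in simp)

lemma nickel_map_row:
  assumes g: "g \<in> carrier G" and j: "j < d"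
  shows "fun_act G g (fs ! j) x = (\<Sum>k<d. of_int (A g $$ (j, k)) * (fs ! k) x)"
    and "A g $$ (j, j) = 1" and "k < j \<Longrightarrow> A g $$ (j, k) = 0"
proof -
  obtain cs :: "int list" where cs: "length cs = d" "fun_act G g (fs ! j) = lincomb (map of_int cs) fs"
    "cs ! j = 1" "\<forall>k < j. cs ! k = 0"
    using fs_basis g j unfolding nickel_basis_def by blast
  have "(THE cs::int list. length cs = d \<and> fun_act G g (fs ! j) = lincomb (map of_int cs) fs) = cs"
    by (rule the_equality) (use cs fs_int_unique in auto)
  then have A: "A g $$ (j, k) = cs ! k" if "k < d" for k
    using that j by (simp add: nickel_map_def)
  show "fun_act G g (fs ! j) x = (\<Sum>k<d. of_int (A g $$ (j, k)) * (fs ! k) x)"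
    unfolding cs(2) using cs(1) by (simp add: lincomb_def A)
  show "A g $$ (j, j) = 1" "k < j \<Longrightarrow> A g $$ (j, k) = 0"
    using A j cs by auto
qed

lemma nickel_map_carrier [simp]: "A g \<in> carrier_mat d d"
  by (simp add: nickel_map_def)

lemma nickel_map_unitri: "g \<in> carrier G \<Longrightarrow> unitri d 1 (A g)"
  unfolding unitri_def using nickel_map_row(2,3) by (auto simp: less_Suc_eq)

lemma nickel_map_UT: "g \<in> carrier G \<Longrightarrow> A g \<in> carrier (UT d)"
  using nickel_map_unitri by (simp add: carrier_UT)

lemma nickel_map_eqI:
  assumes g: "g \<in> carrier G" and B: "B \<in> carrier_mat d d"
    and eq: "\<And>j x. j < d \<Longrightarrow> fun_act G g (fs ! j) x = (\<Sum>k<d. of_int (B $$ (j, k)) * (fs ! k) x)"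
  shows "A g = B"
proof (rule eq_matI)
  fix j k assume "j < dim_row B" "k < dim_col B"
  then have jk: "j < d" "k < d" using B by auto
  have "rat_of_int (A g $$ (j, k)) = of_int (B $$ (j, k))"
    using nickel_map_row(1)[OF g jk(1)] eq[OF jk(1)] jk(2)
    by (intro fs_independent[where a = "\<lambda>k. rat_of_int (A g $$ (j, k))"
          and b = "\<lambda>k. rat_of_int (B $$ (j, k))"]) simp_all
  then show "A g $$ (j, k) = B $$ (j, k)" by simp
qed (use B in \<open>auto simp: nickel_map_def\<close>)

text \<open>\<open>fun_act\<close> is a right action: \<open>g \<otimes> h\<close> acts by
  \<open>g\<close> first, then by \<open>h\<close>. Storing coefficients in rows makes this a
  homomorphism.\<close>

lemma nickel_map_mult:
  assumes g: "g \<in> carrier G" and h: "h \<in> carrier G"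
  shows "A (g \<otimes> h) = A g * A h"
proof (rule nickel_map_eqI)
  fix j x assume j: "j < d"
  have "fun_act G (g \<otimes> h) (fs ! j) x = fun_act G h (fun_act G g (fs ! j)) x"
    using g h by (simp add: fun_act_def inv_mult_group m_assoc)
  also have "\<dots> = (\<Sum>k<d. of_int (A g $$ (j, k)) * fun_act G h (fs ! k) x)"
    using h by (simp add: fun_act_def[of G h] nickel_map_row(1)[OF g j])
  also have "\<dots> = (\<Sum>k<d. \<Sum>l<d. of_int (A g $$ (j, k)) * (of_int (A h $$ (k, l)) * (fs ! l) x))"
    by (intro sum.cong) (simp_all add: nickel_map_row(1)[OF h] sum_distrib_left)
  also have "\<dots> = (\<Sum>l<d. \<Sum>k<d. of_int (A g $$ (j, k)) * (of_int (A h $$ (k, l)) * (fs ! l) x))"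
    by (rule sum.swap)
  also have "\<dots> = (\<Sum>l<d. of_int ((A g * A h) $$ (j, l)) * (fs ! l) x)"
    by (intro sum.cong)
      (simp_all add: index_mult_mat_sum[of _ d] j sum_distrib_right mult.assoc del: index_mult_mat)
  finally show "fun_act G (g \<otimes> h) (fs ! j) x = (\<Sum>l<d. of_int ((A g * A h) $$ (j, l)) * (fs ! l) x)" .
qed (use g h mult_carrier_mat[OF nickel_map_carrier nickel_map_carrier] in auto)

lemma nickel_map_one: "A \<one> = 1\<^sub>m d"
proof (rule nickel_map_eqI)
  fix j x assume j: "j < d"
  have "fun_act G \<one> (fs ! j) x = (fs ! j) x"
    using module_vanishes[OF fs_module[OF j]] by (simp add: fun_act_def)
  also have "\<dots> = (\<Sum>k<d. of_int (1\<^sub>m d $$ (j, k)) * (fs ! k) x)"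
    using j by (simp add: if_distrib[of rat_of_int] if_distrib[of "\<lambda>y. y * _"] cong: if_cong)
  finally show "fun_act G \<one> (fs ! j) x = (\<Sum>k<d. of_int (1\<^sub>m d $$ (j, k)) * (fs ! k) x)" .
qed auto

lemma module_poly:
  assumes "f \<in> nickel_module G xs"
  shows "poly_on (carrier G) (Suc c) f"
proof -
  obtain ps cs where ps: "set ps \<subseteq> carrier G \<times> {..< length xs}"
    "f = lincomb cs (map (\<lambda>(g, i). fun_act G g (malcev_coord G xs i)) ps)"
    using assms unfolding nickel_module_def by blast
  have "poly_on (carrier G) (Suc c) (map (\<lambda>(g, i). fun_act G g (malcev_coord G xs i)) ps ! j)"
    if j: "j < length ps" for j
  proof -
    obtain g i where gi: "ps ! j = (g, i)" by force
    then have g: "g \<in> carrier G" "i < length xs" using ps(1) nth_mem[OF j] by auto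
    have "poly_on (carrier G) (Suc c) (fun_act G g (malcev_coord G xs i))"
      using g by (intro poly_on_cong[OF subgroup_self
            poly_on_translate[OF subgroup_self _ malcev_coord_poly[of i], of "inv g"]])
        (auto simp: fun_act_def)
    then show ?thesis using j gi by simp
  qed
  then show ?thesis
    unfolding ps(2) lincomb_def by (intro poly_on_sum subgroup_self) auto
qed

lemma malcev_coord_span:
  assumes "j < length xs"
  shows "\<exists>cs. \<forall>h \<in> carrier G. malcev_coord G xs j h = (\<Sum>k<d. cs ! k * (fs ! k) h)"
proof -
  let ?t = "malcev_coord G xs j"
  have "fun_act G \<one> ?t = lincomb [1] (map (\<lambda>(g, i). fun_act G g (malcev_coord G xs i)) [(\<one>, j)])"
    by (simp add: lincomb_def)
  then have "fun_act G \<one> ?t \<in> nickel_module G xs"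
    using assms unfolding nickel_module_def
    by (intro CollectI exI[of _ "[(\<one>, j)]"] exI[of _ "[1]"]) simp
  then obtain cs where cs: "fun_act G \<one> ?t = lincomb cs fs"
    using fs_basis unfolding nickel_basis_def by blast
  have "?t h = (\<Sum>k<d. cs ! k * (fs ! k) h)" if "h \<in> carrier G" for h
    using fun_cong[OF cs, of h] that by (simp add: fun_act_def lincomb_def)
  then show ?thesis by blast
qed

lemma fs_separate:
  assumes "g \<in> carrier G" "h \<in> carrier G" "\<And>k. k < d \<Longrightarrow> (fs ! k) g = (fs ! k) h"
  shows "g = h"
proof (rule malcev_coords_separate[OF assms(1,2)])
  fix j assume "j < length xs"
  then obtain cs where "\<forall>h \<in> carrier G. malcev_coord G xs j h = (\<Sum>k<d. cs ! k * (fs ! k) h)"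
    using malcev_coord_span by blast
  then show "malcev_coord G xs j g = malcev_coord G xs j h" using assms by simp
qed

lemma nickel_map_inj: "inj_on A (carrier G)"
proof (rule inj_onI)
  fix g h assume g: "g \<in> carrier G" and h: "h \<in> carrier G" and eq: "A g = A h"
  have "(fs ! k) (inv g) = (fs ! k) (inv h)" if "k < d" for k
  proof -
    have "fun_act G g (fs ! k) \<one> = fun_act G h (fs ! k) \<one>"
      using nickel_map_row(1) g h that eq by simp
    then show ?thesis using g h by (simp add: fun_act_def)
  qed
  then have "inv g = inv h" by (intro fs_separate inv_closed g h)
  then have "inv (inv g) = inv (inv h)" by (rule arg_cong)
  then show "g = h" using g h by simp
qed

text \<open>The last row of a unitriangular matrix is a unit vector, so the last basis function is
  invariant under all translations; linear independence makes it nonzero.\<close>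

lemma fs_last_const:
  assumes d: "d > 0"
  shows "\<exists>r. r \<noteq> 0 \<and> (\<forall>g \<in> carrier G. (fs ! (d - 1)) g = r)"
proof -
  let ?f = "fs ! (d - 1)"
  have const: "?f g = ?f \<one>" if g: "g \<in> carrier G" for g
  proof -
    have ig: "inv g \<in> carrier G" using g by simp
    have "fun_act G (inv g) ?f \<one> = (\<Sum>k<d. of_int (A (inv g) $$ (d - 1, k)) * (fs ! k) \<one>)"
      using d ig by (intro nickel_map_row(1)) auto
    also have "\<dots> = (\<Sum>k<d. if k = d - 1 then ?f \<one> else 0)"
      using nickel_map_row(2,3)[OF ig, of "d - 1"] d by (intro sum.cong) auto
    also have "\<dots> = ?f \<one>" using d by simp
    finally show ?thesis using g by (simp add: fun_act_def)
  qed
  have "?f \<one> \<noteq> 0"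
  proof
    assume "?f \<one> = 0"
    then have "?f x = 0" for x
      using const module_vanishes[OF fs_module, of "d - 1" x] d by (cases "x \<in> carrier G") auto
    then have "of_bool (d - 1 = d - 1) = (0::rat)"
      using d by (intro fs_independent[where a = "\<lambda>k. of_bool (k = d - 1)" and b = "\<lambda>_. 0"])
        (auto simp: of_bool_def if_distrib[of "\<lambda>y. y * _"] cong: if_cong)
    then show False by simp
  qed
  then show ?thesis using const by blast
qed

text \<open>Elements of weight \<open>c\<close> move every function of the module by a constant, and the constants
  are spanned by the last basis function.\<close>

lemma nickel_map_central:
  assumes h: "h \<in> Iso c" and c: "c \<ge> 1" and jk: "j < d" "k < d" "k \<noteq> d - 1"
  shows "A h $$ (j, k) = of_bool (j = k)"
proof -
  let ?f = "fs ! j"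
  have d: "d > 0" using jk by linarith
  obtain r where r: "r \<noteq> 0" "\<And>g. g \<in> carrier G \<Longrightarrow> (fs ! (d - 1)) g = r"
    using fs_last_const[OF d] by blast
  have hc: "h \<in> carrier G" using h by (simp add: isolator_def)
  have ih: "inv h \<in> Iso c" using h by (rule subgroup.m_inv_closed[OF Iso_subgroup[OF c]])
  \<comment> \<open>Translation by \<open>h\<close> adds the constant
    \<open>?f (inv h) - ?f \<one>\<close>; division by \<open>r\<close> expresses it through the
    last basis function.\<close>
  define s where "s = (?f (inv h) - ?f \<one>) / r"
  have "rat_of_int (A h $$ (j, k)) = of_bool (j = k) + s * of_bool (k = d - 1)"
  proof (rule fs_independent[where a = "\<lambda>k. rat_of_int (A h $$ (j, k))"
        and b = "\<lambda>k. of_bool (j = k) + s * of_bool (k = d - 1)"])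
    fix x
    have "(\<Sum>k<d. (of_bool (j = k) + s * of_bool (k = d - 1)) * (fs ! k) x)
      = (\<Sum>k<d. if k = j then ?f x else 0) + (\<Sum>k<d. if k = d - 1 then s * (fs ! (d - 1)) x else 0)"
      unfolding sum.distrib[symmetric] by (intro sum.cong) (auto simp: algebra_simps)
    also have "\<dots> = ?f x + s * (fs ! (d - 1)) x" using jk d by simp
    also have "\<dots> = fun_act G h ?f x"
    proof (cases "x \<in> carrier G")
      case True
      then show ?thesis
        using r central_translate[OF module_poly[OF fs_module[OF jk(1)]] ih c True]
        by (simp add: fun_act_def s_def)
    next
      case False
      then show ?thesis
        using module_vanishes[OF fs_module[OF jk(1)]] module_vanishes[OF fs_module, of "d - 1" x] d
        by (simp add: fun_act_def)
    qed
    finally show "(\<Sum>k<d. rat_of_int (A h $$ (j, k)) * (fs ! k) x)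
      = (\<Sum>k<d. (of_bool (j = k) + s * of_bool (k = d - 1)) * (fs ! k) x)"
      using nickel_map_row(1)[OF hc jk(1)] by simp
  qed (use jk in simp)
  then have "rat_of_int (A h $$ (j, k)) = rat_of_int (of_bool (j = k))" using jk by simp
  then show ?thesis by (simp only: of_int_eq_iff)
qed

text \<open>Each commutator gains a superdiagonal. Writing it as
  \<open>inv (y \<otimes> x) \<otimes> (x \<otimes> y)\<close> fits
  \<open>unitri_commutator\<close>.\<close>

lemma lcs_unitri: "g \<in> lcs G k \<Longrightarrow> unitri d (Suc k) (A g)"
proof (induction k arbitrary: g)
  case 0
  then show ?case using nickel_map_unitri by simp
next
  case (Suc k)
  let ?U = "{g \<in> carrier G. unitri d (Suc (Suc k)) (A g)}"
  let ?S = "{cmt x y |x y. x \<in> lcs G k \<and> y \<in> carrier G}"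
  have "subgroup ?U G"
  proof (rule subgroupI)
    have "\<one> \<in> ?U" by (simp add: nickel_map_one unitri_def)
    then show "?U \<noteq> {}" by blast
    fix g assume g: "g \<in> ?U"
    then have "A g * A (inv g) = 1\<^sub>m d" by (simp add: nickel_map_one flip: nickel_map_mult)
    then show "inv g \<in> ?U" using g unitri_inverse nickel_map_unitri by auto
    fix h assume h: "h \<in> ?U"
    then show "g \<otimes> h \<in> ?U" using g by (auto simp: nickel_map_mult intro!: unitri_mult)
  qed auto
  moreover have "?S \<subseteq> ?U"
  proof
    fix z assume "z \<in> ?S"
    then obtain x y where z: "z = cmt x y" "x \<in> lcs G k" "y \<in> carrier G" by blast
    then have x: "x \<in> carrier G" using lcs_carrier by blast
    let ?i = "inv (y \<otimes> x)"
    have "z = ?i \<otimes> (x \<otimes> y)" using x z by (simp add: inv_mult_group m_assoc)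
    then have Az: "A z = A ?i * (A x * A y)" using x z(3) by (simp add: nickel_map_mult)
    have "A ?i * (A y * A x) = 1\<^sub>m d"
      using x z(3) nickel_map_mult[of ?i "y \<otimes> x"] nickel_map_mult[of y x] nickel_map_one by simp
    then have "unitri d (Suc (Suc k)) (A z)"
      unfolding Az using Suc.IH[OF z(2)] x z(3) by (intro unitri_commutator nickel_map_unitri) auto
    then show "z \<in> ?U" using x z by simp
  qed
  ultimately have "generate G ?S \<subseteq> ?U" by (rule generate_subgroup_incl[rotated])
  then show ?case using Suc.prems by auto
qed

text \<open>\<open>A g - 1\<close> lives in the last column and the last row of
  \<open>A h - 1\<close> is zero, so their product vanishes.\<close>

lemma central_entry_mult:
  assumes c: "c \<ge> 1" and g: "g \<in> Iso c" and h: "h \<in> Iso c" and i: "Suc i < d"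
  shows "A (g \<otimes> h) $$ (i, d - 1) = A g $$ (i, d - 1) + A h $$ (i, d - 1)"
proof -
  have gh: "g \<in> carrier G" "h \<in> carrier G" using g h by (simp_all add: isolator_def)
  have "(A g $$ (i, k) - of_bool (i = k)) * (A h $$ (k, d - 1) - of_bool (k = d - 1)) = 0" if "k < d" for k
  proof (cases "k = d - 1")
    case True
    then show ?thesis using nickel_map_row(2)[OF gh(2), of "d - 1"] i by simp
  next
    case False
    then show ?thesis using nickel_map_central[OF g c, of i k] i that by simp
  qed
  then have "(\<Sum>k<d. (A g $$ (i, k) - of_bool (i = k)) * (A h $$ (k, d - 1) - of_bool (k = d - 1))) = 0"
    by (intro sum.neutral) simp
  then show ?thesis
    unfolding nickel_map_mult[OF gh]
    using index_mult_mat_unipotent[of "A g" d "A h" i "d - 1"] i by simp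
qed

lemma central_entry_pow:
  assumes c: "c \<ge> 1" and g: "g \<in> Iso c" and i: "Suc i < d"
  shows "A (g [^] (n::int)) $$ (i, d - 1) = n * A g $$ (i, d - 1)"
proof -
  have gc: "g \<in> carrier G" using g by (simp add: isolator_def)
  have pow: "g [^] (n::int) \<in> Iso c" for n
    by (rule subgroup_int_pow_closed[OF Iso_subgroup[OF c] g])
  have one: "A \<one> $$ (i, d - 1) = 0" using i by (simp add: nickel_map_one)
  have nat: "A (g [^] int n) $$ (i, d - 1) = int n * A g $$ (i, d - 1)" for n
  proof (induction n)
    case (Suc n)
    have "g [^] int (Suc n) = g [^] int n \<otimes> g"
      using gc int_pow_mult[of g "int n" 1] by (simp add: add.commute)
    then show ?case using Suc central_entry_mult[OF c pow[of "int n"] g i] by (simp add: algebra_simps)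
  qed (use one in simp)
  show ?thesis
  proof (cases "n \<ge> 0")
    case True
    then show ?thesis using nat[of "nat n"] by simp
  next
    case False
    have "g [^] n \<otimes> g [^] (- n) = \<one>" using gc by (simp flip: int_pow_mult)
    then have "A (g [^] n) $$ (i, d - 1) + A (g [^] (- n)) $$ (i, d - 1) = 0"
      using central_entry_mult[OF c pow[of n] pow[of "- n"] i] one by simp
    then show ?thesis using nat[of "nat (- n)"] False by simp
  qed
qed

lemma nickel_map_foldr:
  "set ws \<subseteq> carrier G \<Longrightarrow> A (foldr (\<otimes>) ws \<one>) = foldr (\<otimes>\<^bsub>UT d\<^esub>) (map A ws) \<one>\<^bsub>UT d\<^esub>"
proof (induction ws)
  case (Cons w ws)
  have "foldr (\<otimes>) ws \<one> \<in> carrier G" using Cons.prems by (induction ws) auto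
  then show ?case using Cons by (simp add: nickel_map_mult)
qed (simp add: nickel_map_one)

end

section \<open>Distortion\<close>

lemma power_not_dominated:
  fixes B \<kappa> t :: rat
  assumes "\<And>n. n \<ge> 1 \<Longrightarrow> \<bar>t + of_nat (n ^ Suc c) * \<kappa>\<bar> \<le> B * (1 + of_nat (L * n)) ^ c"
    and "B \<ge> 0"
  shows "\<kappa> = 0"
proof (rule ccontr)
  assume "\<kappa> \<noteq> 0"
  \<comment> \<open>From \<open>1 + L * n \<le> (1 + L) * n\<close> the bound becomes
    \<open>D * n ^ c\<close>, which n^(c+1) eventually exceeds.\<close>
  define D where "D = \<bar>t\<bar> + B * (1 + of_nat L) ^ c"
  obtain n where n: "D < of_nat n * \<bar>\<kappa>\<bar>"
    using \<open>\<kappa> \<noteq> 0\<close> ex_less_of_nat_mult[of "\<bar>\<kappa>\<bar>" D] by auto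
  have "D \<ge> 0" using \<open>B \<ge> 0\<close> by (simp add: D_def)
  then have n1: "n \<ge> 1" using n by (cases n) auto
  have "of_nat (n ^ Suc c) * \<bar>\<kappa>\<bar> \<le> \<bar>t\<bar> + \<bar>t + of_nat (n ^ Suc c) * \<kappa>\<bar>"
    by (simp add: abs_mult flip: abs_of_nat[of "n ^ Suc c", where ?'a = rat] del: abs_of_nat of_nat_power)
  also have "\<dots> \<le> \<bar>t\<bar> + B * (1 + of_nat (L * n)) ^ c"
    using assms(1)[OF n1] by simp
  also have "\<dots> \<le> \<bar>t\<bar> * of_nat n ^ c + B * ((1 + of_nat L) * of_nat n) ^ c"
  proof (rule add_mono)
    have "1 \<le> (of_nat n :: rat) ^ c" using n1 by (intro one_le_power) simp
    then show "\<bar>t\<bar> \<le> \<bar>t\<bar> * of_nat n ^ c" by (simp add: mult_le_cancel_left1)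
    show "B * (1 + of_nat (L * n)) ^ c \<le> B * ((1 + of_nat L) * of_nat n) ^ c"
      using n1 \<open>B \<ge> 0\<close> by (intro mult_left_mono power_mono) (auto simp: algebra_simps)
  qed
  also have "\<dots> = D * of_nat n ^ c"
    unfolding D_def power_mult_distrib by (simp add: distrib_right)
  finally have "of_nat n * \<bar>\<kappa>\<bar> * of_nat n ^ c \<le> D * of_nat n ^ c"
    by (simp add: algebra_simps)
  moreover have "(0::rat) < of_nat n ^ c" using n1 by simp
  ultimately have "of_nat n * \<bar>\<kappa>\<bar> \<le> D" by (rule mult_right_le_imp_le)
  then show False using n by simp
qed

context nickel_group
begin

lemma central_pow_last_col:
  assumes c: "c \<ge> 1" and d: "d > 0" and h: "h \<in> Iso c"
    and zero: "\<And>i. d - 1 - c \<le> i \<Longrightarrow> Suc i < d \<Longrightarrow> A h $$ (i, d - 1) = 0"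
  shows "A (h [^] (n::nat)) = last_col_mat d (d - 1 - c) (\<lambda>i. A h $$ (i, d - 1) * int n)"
proof -
  have hc: "h \<in> carrier G" using h by (simp add: isolator_def)
  have hn: "h [^] int n \<in> Iso c" by (rule subgroup_int_pow_closed[OF Iso_subgroup[OF c] h])
  have "A (h [^] int n) = last_col_mat d (d - 1 - c) (\<lambda>i. A h $$ (i, d - 1) * int n)" (is "?L = ?R")
  proof (rule eq_matI)
    fix i j assume "i < dim_row ?R" "j < dim_col ?R"
    then have ij: "i < d" "j < d" by (auto simp: last_col_mat_def)
    show "?L $$ (i, j) = ?R $$ (i, j)"
    proof (cases "j = d - 1 \<and> i \<noteq> j")
      case True
      then have i: "Suc i < d" using ij by auto
      show ?thesis
        using True ij central_entry_pow[OF c h i, of "int n"] zero[OF _ i]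
        by (auto simp: last_col_mat_def)
    next
      case False
      then show ?thesis
        using ij nickel_map_central[OF hn c ij] nickel_map_row(2)[of "h [^] int n" i] hc
        by (auto simp: last_col_mat_def)
    qed
  qed (auto simp: last_col_mat_def nickel_map_def)
  then show ?thesis by (simp add: int_pow_int)
qed

text \<open>The critical entry is additive and integer-valued on \<open>Iso c\<close>, so its values
  at two basis elements satisfy a nontrivial integer relation.\<close>

lemma exists_distorted_central:
  assumes c: "c \<ge> 1" and bs: "free_basis G (lcs G (c - 1)) bs" "length bs \<ge> 2"
  shows "\<exists>h \<in> Iso c. h \<noteq> \<one> \<and> (\<forall>i. d - 1 - c \<le> i \<longrightarrow> Suc i < d \<longrightarrow> A h $$ (i, d - 1) = 0)"
proof -
  obtain b1 b2 bs' where bseq: "bs = b1 # b2 # bs'"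
    using bs(2) by (auto simp: numeral_2_eq_2 Suc_le_length_iff)
  have b: "b1 \<in> lcs G (c - 1)" "b2 \<in> lcs G (c - 1)"
    using bs(1) bseq by (auto simp: free_basis_def)
  \<comment> \<open>If \<open>d \<le> c\<close> there is no c-th superdiagonal and the truncated row
    index would be meaningless.\<close>
  define e where "e g = (if c < d then A g $$ (d - 1 - c, d - 1) else 0)" for g
  obtain p q :: int where pq: "p * e b1 + q * e b2 = 0" "p \<noteq> 0 \<or> q \<noteq> 0"
  proof (cases "e b1 = 0 \<and> e b2 = 0")
    case True
    then show ?thesis using that[of 1 0] by simp
  next
    case False
    then show ?thesis using that[of "e b2" "- e b1"] by auto
  qed
  define h where "h = b1 [^] p \<otimes> b2 [^] q"
  have lcs_Iso: "lcs G (c - 1) \<subseteq> Iso c"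
    using lcs_subset_isolator[of "c - 1"] by (simp add: lower_central_def)
  have pow: "b1 [^] p \<in> lcs G (c - 1)" "b2 [^] q \<in> lcs G (c - 1)"
    by (rule subgroup_int_pow_closed[OF lcs_subgroup], rule b)+
  have h: "h \<in> lcs G (c - 1)"
    unfolding h_def by (rule subgroup.m_closed[OF lcs_subgroup pow])
  have "h \<noteq> \<one>"
  proof
    assume "h = \<one>"
    have bsc: "set bs \<subseteq> carrier G" using bs(1) lcs_carrier by (auto simp: free_basis_def)
    have zeros: "word_prod G ys (replicate (length ys) 0) = \<one>" if "set ys \<subseteq> carrier G" for ys
      using word_prod_replicate_zero[OF that, of "length ys" "[]"] by simp
    \<comment> \<open>The element \<open>\<one>\<close> has only the zero exponent vector over
      \<open>bs\<close>, whereas \<open>p\<close> and \<open>q\<close> are not both zero.\<close>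
    have "word_prod G bs (p # q # replicate (length bs') 0) = h"
      using zeros[of bs'] bsc unfolding bseq h_def by simp
    moreover have "word_prod G bs (replicate (length bs) 0) = \<one>" by (rule zeros[OF bsc])
    moreover have "\<exists>!as. length as = length bs \<and> \<one> = word_prod G bs as"
      using bs(1) subgroup.one_closed[OF lcs_subgroup] unfolding free_basis_def by blast
    ultimately have "p # q # replicate (length bs') 0 = replicate (length bs) 0"
      using \<open>h = \<one>\<close> bseq by (metis length_Cons length_replicate)
    then show False using pq(2) bseq by simp
  qed
  moreover have "A h $$ (i, d - 1) = 0" if i: "d - 1 - c \<le> i" "Suc i < d" for i
  proof (cases "i + c = d - 1")
    case True
    then have "i = d - 1 - c" "c < d" using i by auto
    then have e: "e g = A g $$ (i, d - 1)" for g by (simp add: e_def)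
    have Iso: "b1 \<in> Iso c" "b2 \<in> Iso c" "b1 [^] p \<in> Iso c" "b2 [^] q \<in> Iso c"
      using b pow lcs_Iso by auto
    show ?thesis
      using pq(1) unfolding h_def central_entry_mult[OF c Iso(3,4) i(2)]
        central_entry_pow[OF c Iso(1) i(2)] central_entry_pow[OF c Iso(2) i(2)] e .
  next
    case False
    then have "d - 1 < i + Suc (c - 1)" using i c by linarith
    then show ?thesis using lcs_unitri[OF h] i unfolding unitri_def by simp
  qed
  ultimately show ?thesis using h lcs_Iso by blast
qed

text \<open>Undistortedness converts O(n) words over \<open>SK\<close> into O(n) words over
  \<open>SH\<close>, which injectivity of \<open>A\<close> pulls back to \<open>G\<close>; there
  they violate the growth bound of a coordinate.\<close>

lemma nickel_image_distorted:
  assumes c: "c \<ge> 1" and nontrivial: "carrier G \<noteq> {\<one>}"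
    and bs: "free_basis G (lcs G (c - 1)) bs" "length bs \<ge> 2"
  shows "\<not> undistorted (UT d) (A ` carrier G)"
proof
  let ?K = "UT d" and ?H = "A ` carrier G"
  assume "undistorted ?K ?H"
  then obtain SK SH and C :: real where SK: "finite SK" "generate ?K SK = carrier ?K"
    and SH: "finite SH" "SH \<subseteq> ?H" "generate ?K SH = ?H"
    and C: "\<And>n. real (distortion ?K SK ?H SH n) \<le> C * real n"
    unfolding undistorted_def by blast
  have d: "d > 0"
  proof (rule ccontr)
    assume "\<not> d > 0"
    then have "g = \<one>" if "g \<in> carrier G" for g using that fs_separate[of g \<one>] by simp
    then show False using nontrivial by auto
  qed
  obtain h where h: "h \<in> Iso c" "h \<noteq> \<one>"
    and zero: "\<And>i. d - 1 - c \<le> i \<Longrightarrow> Suc i < d \<Longrightarrow> A h $$ (i, d - 1) = 0"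
    using exists_distorted_central[OF c bs] by blast
  have hc: "h \<in> carrier G" using h by (simp add: isolator_def)
  define N where "N n = n ^ Suc c" for n :: nat

  \<comment> \<open>Rows \<open>i < d - 1 - c\<close> satisfy \<open>i + Suc c < d\<close>, exactly
    the room that exponent \<open>Suc c\<close> requires.\<close>
  have "\<exists>C0. \<forall>n \<ge> 1. word_le ?K SK (C0 * n)
      (last_col_mat d (d - 1 - c) (\<lambda>i. A h $$ (i, d - 1) * int n ^ Suc c))"
    using d by (intro word_le_last_col[OF SK(2)]) auto
  moreover have "A (h [^] N n) = last_col_mat d (d - 1 - c) (\<lambda>i. A h $$ (i, d - 1) * int n ^ Suc c)" for n
    using central_pow_last_col[OF c d h(1) zero, of "N n"] by (simp add: N_def)
  ultimately obtain C0 where C0: "\<And>n. n \<ge> 1 \<Longrightarrow> word_le ?K SK (C0 * n) (A (h [^] N n))"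
    by auto
  \<comment> \<open>\<open>C\<close> is an arbitrary real, so its absolute value is rounded up to a
    natural number.\<close>
  define L where "L = nat \<lceil>\<bar>C\<bar>\<rceil> * C0"
  have HK: "?H \<subseteq> carrier ?K" using nickel_map_UT by auto
  have lettersK: "SK \<union> m_inv ?K ` SK \<subseteq> carrier ?K" by (rule UT_letters[OF SK(2)])
  have lettersH: "SH \<union> m_inv ?K ` SH \<subseteq> ?H"
    using SH(3) generate.incl[of _ SH ?K] generate.inv[of _ SH ?K] by auto
  have wordH: "word_le ?K SH (L * n) (A (h [^] N n))" if n: "n \<ge> 1" for n
  proof -
    let ?g = "A (h [^] N n)"
    have g: "?g \<in> ?H" using hc by simp
    then obtain m where "word_le ?K SH m ?g"
      using monoid.generate_word_le[OF monoid_UT, of SH d ?g] lettersH HK SH(3) by blast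
    then have *: "word_le ?K SH (word_length ?K SH ?g) ?g" by (rule word_length_attained)
    have "word_length ?K SH ?g \<le> distortion ?K SK ?H SH (C0 * n)"
    proof (rule word_length_le_distortion[OF SK(1) _ g C0[OF n]])
      show "\<exists>m. word_le ?K SK m k" if "k \<in> ?H" for k
        using monoid.generate_word_le[OF monoid_UT lettersK, of k] that HK SK(2) by blast
    qed
    then have "real (word_length ?K SH ?g) \<le> C * real (C0 * n)"
      using C[of "C0 * n"] by linarith
    also have "\<dots> \<le> real (nat \<lceil>\<bar>C\<bar>\<rceil>) * real (C0 * n)"
      by (intro mult_right_mono) linarith+
    also have "\<dots> = real (L * n)" by (simp add: L_def)
    finally have "word_length ?K SH ?g \<le> L * n" by linarith
    with * show ?thesis by (rule word_le_mono)
  qed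
  \<comment> \<open>Preimages of the letters and of their inverses alike, so inverses in
    \<open>UT d\<close> are never compared with inverses in \<open>G\<close>.\<close>
  define T where "T = inv_into (carrier G) A ` (SH \<union> m_inv ?K ` SH)"
  have T: "finite T" "T \<subseteq> carrier G"
    using SH(1) lettersH inv_into_into[of _ A "carrier G"] by (auto simp: T_def)
  have wordG: "\<exists>ws. set ws \<subseteq> T \<and> length ws \<le> L * n \<and> foldr (\<otimes>) ws \<one> = h [^] N n" if n: "n \<ge> 1" for n
  proof -
    obtain us where us: "length us \<le> L * n" "set us \<subseteq> SH \<union> m_inv ?K ` SH"
      "foldr (\<otimes>\<^bsub>?K\<^esub>) us \<one>\<^bsub>?K\<^esub> = A (h [^] N n)"
      using wordH[OF n] unfolding word_le_def by blast
    let ?ws = "map (inv_into (carrier G) A) us"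
    have ws: "set ?ws \<subseteq> T" using us(2) by (auto simp: T_def)
    have "set us \<subseteq> ?H" using us(2) lettersH by (rule order_trans)
    then have "map A ?ws = us"
      by (auto intro!: map_idI f_inv_into_f[of _ A "carrier G"] simp: comp_def)
    then have "A (foldr (\<otimes>) ?ws \<one>) = A (h [^] N n)"
      using nickel_map_foldr[of ?ws] ws T us(3) by auto
    moreover have "foldr (\<otimes>) vs \<one> \<in> carrier G" if "set vs \<subseteq> T" for vs
      using that T by (induction vs) auto
    ultimately have "foldr (\<otimes>) ?ws \<one> = h [^] N n"
      using nickel_map_inj ws hc by (simp add: inj_on_eq_iff del: foldr_map)
    then show ?thesis using ws us(1) by (intro exI[of _ ?ws]) simp
  qed
  \<comment> \<open>Along powers of \<open>h\<close> this coordinate is affine in the exponent with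
    nonzero slope, by \<open>central_pow\<close>.\<close>
  obtain j where j: "j < length xs" "malcev_coord G xs j h \<noteq> malcev_coord G xs j \<one>"
    using malcev_coords_separate[OF hc one_closed] h(2) by blast
  let ?t = "malcev_coord G xs j"
  note poly = malcev_coord_poly[OF j(1)]
  obtain B where B: "B \<ge> 0" "\<And>ws. set ws \<subseteq> T \<Longrightarrow>
      \<bar>?t (foldr (\<otimes>) ws \<one>)\<bar> \<le> B * (1 + of_nat (length ws)) ^ c"
    using poly_on_word_bound[OF T poly] by blast
  have "?t h - ?t \<one> = 0"
  proof (rule power_not_dominated[OF _ B(1)])
    fix n :: nat assume n: "n \<ge> 1"
    obtain ws where ws: "set ws \<subseteq> T" "length ws \<le> L * n" "foldr (\<otimes>) ws \<one> = h [^] N n"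
      using wordG[OF n] by blast
    have "\<bar>?t \<one> + of_nat (n ^ Suc c) * (?t h - ?t \<one>)\<bar> = \<bar>?t (foldr (\<otimes>) ws \<one>)\<bar>"
      using central_pow[OF poly h(1) c, of "N n"] ws(3) by (simp add: N_def)
    also have "\<dots> \<le> B * (1 + of_nat (length ws)) ^ c" by (rule B(2)[OF ws(1)])
    also have "\<dots> \<le> B * (1 + of_nat (L * n)) ^ c"
      using ws(2) B(1) by (intro mult_left_mono power_mono add_left_mono) (simp_all del: of_nat_mult)
    finally show "\<bar>?t \<one> + of_nat (n ^ Suc c) * (?t h - ?t \<one>)\<bar> \<le> B * (1 + of_nat (L * n)) ^ c" .
  qed
  then show False using j(2) by simp
qed

end

theorem theorem4p7:
  fixes G :: "('a, 'b) monoid_scheme"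
  assumes "tau_group G"
    and "c = nilpotency_class G"
    and "\<exists>bs. free_basis G (lower_central G c) bs \<and> length bs \<ge> 2"
  shows "\<forall>xs fs. nickel_malcev_basis G xs \<and> nickel_basis G xs fs \<longrightarrow>
           \<not> undistorted (UT (length fs)) (nickel_map G fs ` carrier G)"
proof (intro allI impI)
  fix xs :: "'a list" and fs :: "('a \<Rightarrow> rat) list"
  assume bases: "nickel_malcev_basis G xs \<and> nickel_basis G xs fs"
  interpret group G using assms(1) by (simp add: tau_group_def)
  interpret nickel_group G xs fs
    by unfold_locales (use assms(1) bases in \<open>auto simp: tau_group_def\<close>)
  have nontrivial: "carrier G \<noteq> {\<one>\<^bsub>G\<^esub>}"
    using assms(1) unfolding tau_group_def by fastforce
  have "nilpotency_class G \<noteq> 0"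
    using lcs_class nontrivial by (metis lcs.simps(1))
  then have c: "nilpotency_class G \<ge> 1" by simp
  obtain bs where bs: "free_basis G (lcs G (nilpotency_class G - 1)) bs" "length bs \<ge> 2"
    using assms(2,3) unfolding lower_central_def by blast
  show "\<not> undistorted (UT (length fs)) (nickel_map G fs ` carrier G)"
    by (rule nickel_image_distorted[OF c nontrivial bs])
qed

end
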